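(* Let $T$ be a Markov–Rényi map with parameter $\gamma>1$. Let $J(\infty)=\{x\in I:\lambda(x)=\infty\}$, where $\lambda(x)=\lim_{n\to\infty}\frac1n\log|(T^n)'(x)|$ is the Lyapunov exponent (at points $x$ where the derivatives $(T^n)'(x)$ are all defined and the limit exists in $[-\infty,\infty]$), and let $L(\infty)=\dim_{\rm H}J(\infty)$. Then $$L(\infty)=\frac1\gamma.$$
   Context: $\mathbb N=\{1,2,3,\dots\}$, $I=[0,1]$; $\dim_{\rm H}$ is Hausdorff dimension. Markov–Rényi map: let $\{I_n\}_{n\in\mathbb N}$ be disjoint open subintervals of $[0,1]$. A piecewise differentiable map $T:\bigcup_{n}\overline{I}_n\to[0,1]$ is a Markov–Rényi map associated with $\{I_n\}$ if: (1) for every $n$, $\partial I_n\cap\partial I_{n+1}$ is a singleton; (2) for every $n$, $T|_{I_n}$ extends to a $C^1$ diffeomorphism $T_n$ on an open neighborhood of $\overline I_n$; (3) there exist $p\in\bigcup_n\overline I_n$ and $m\in\mathbb N$ such that $T(p)=p$, $|T'(p)|\ge1$ and $|(T^m)'(x)|>1$ for all $x\in\bigcup_n\overline I_n\setminus\{p\}$; (4) $\overline{T(I_n)}=[0,1]$ for every $n$; (5) there exist constants $\gamma>1$ and $C>1$ such that $C^{-1}n^\gamma\le|T_n'(x)|\le Cn^\gamma$ for all $n\in\mathbb N$, $x\in\overline I_n$. Let $I^*=\bigcup_n\overline I_n$, $\mathcal Q=\bigcup_{k=0}^\infty T^{-k}\big(\{0,1\}\cup\bigcup_n\partial I_n\big)$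 (a countable set), and $\Lambda=I^*\setminus\mathcal Q$. Standing assumption: for every $x\in\Lambda$, all iterates $T^{n-1}(x)$, $n\ge1$, lie in $\bigcup_kI_k$ (so $(T^n)'(x)$ is defined for all $n$). *)

theory Defs
  imports "HOL-Analysis.Analysis"
begin

section \<open>Hausdorff dimension\<close>

text \<open>Summand \<open>(diam U)\<^sup>s\<close>. For \<open>s = 0\<close> it counts nonempty sets; this is spelled out because
  \<open>0 powr 0 = 0\<close> in HOL.\<close>

definition diam_weight :: "real \<Rightarrow> 'a::metric_space set \<Rightarrow> ennreal" where
  "diam_weight s U =
     (if U = {} then 0 else if s = 0 then 1 else ennreal (diameter U powr s))"

text \<open>Boundedness is required separately since \<open>diameter\<close> is meaningful only for bounded sets.\<close>

definition hausdorff_premeasure :: "real \<Rightarrow> real \<Rightarrow> 'a::metric_space set \<Rightarrow> ennreal" where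
  "hausdorff_premeasure s \<delta> E =
     (INF U \<in> {U :: nat \<Rightarrow> 'a set. E \<subseteq> (\<Union>i. U i) \<and> (\<forall>i. bounded (U i) \<and> diameter (U i) \<le> \<delta>)}.
        \<Sum>i. diam_weight s (U i))"

definition hausdorff_measure :: "real \<Rightarrow> 'a::metric_space set \<Rightarrow> ennreal" where
  "hausdorff_measure s E = (SUP \<delta> \<in> {0<..}. hausdorff_premeasure s \<delta> E)"

definition hausdorff_dim :: "'a::metric_space set \<Rightarrow> ereal" where
  "hausdorff_dim E = (INF s \<in> {s. 0 \<le> s \<and> hausdorff_measure s E = 0}. ereal s)"


section \<open>Iterates of a partially defined map\<close>

text \<open>A map defined only on \<open>D\<close> is represented by a total function \<open>T\<close> whose values outside \<open>D\<close> are
  irrelevant: \<open>iter_dom D T n\<close> is the domain of the \<open>n\<close>-th iterate of the partial map.\<close>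

definition iter_dom :: "'a set \<Rightarrow> ('a \<Rightarrow> 'a) \<Rightarrow> nat \<Rightarrow> 'a set" where
  "iter_dom D T n = {x. \<forall>j<n. (T ^^ j) x \<in> D}"

definition iter_preimage :: "'a set \<Rightarrow> ('a \<Rightarrow> 'a) \<Rightarrow> nat \<Rightarrow> 'a set \<Rightarrow> 'a set" where
  "iter_preimage D T n A = {x \<in> iter_dom D T n. (T ^^ n) x \<in> A}"

text \<open>\<open>(T\<^sup>n)'(x) = d\<close>, the derivative being taken relative to the domain of \<open>T\<^sup>n\<close> intersected with
  \<open>S\<close>. Take \<open>S = UNIV\<close> for the usual derivative (which at an interior point of the domain is
  two-sided) and \<open>S = {..x}\<close> or \<open>S = {x..}\<close> for one-sided derivatives. The limit point condition
  makes \<open>d\<close> unique.\<close>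

definition iter_deriv_on ::
  "real set \<Rightarrow> real set \<Rightarrow> (real \<Rightarrow> real) \<Rightarrow> nat \<Rightarrow> real \<Rightarrow> real \<Rightarrow> bool" where
  "iter_deriv_on S D T n x d \<longleftrightarrow>
     x \<in> iter_dom D T n \<and> x islimpt (iter_dom D T n \<inter> S) \<and>
     ((T ^^ n) has_real_derivative d) (at x within (iter_dom D T n \<inter> S))"

abbreviation iter_deriv :: "real set \<Rightarrow> (real \<Rightarrow> real) \<Rightarrow> nat \<Rightarrow> real \<Rightarrow> real \<Rightarrow> bool" where
  "iter_deriv \<equiv> iter_deriv_on UNIV"


section \<open>Markov--Renyi maps\<close>

definition C1_diffeo_on :: "(real \<Rightarrow> real) \<Rightarrow> real set \<Rightarrow> bool" where
  "C1_diffeo_on f U \<longleftrightarrow>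
     open U \<and> open (f ` U) \<and> inj_on f U \<and>
     f C1_differentiable_on U \<and> the_inv_into U f C1_differentiable_on (f ` U)"

text \<open>The intervals are indexed by the positive integers; \<open>J 0\<close> is irrelevant.\<close>

definition I_star :: "(nat \<Rightarrow> real set) \<Rightarrow> real set" where
  "I_star J = (\<Union>n\<in>{1..}. closure (J n))"

text \<open>\<open>Tn n\<close> is the extension of \<open>T\<close> restricted to \<open>J n\<close>. In the expansion condition, \<open>(T\<^sup>m)'\<close> is
  considered at the points where \<open>T\<^sup>m\<close> is defined; at the endpoints of the intervals, where \<open>T\<close> may
  jump, the bound is imposed on each one-sided derivative that exists. For the Gauss map, for
  instance, \<open>T (1/k) = 0\<close> lies outside \<open>I_star J\<close>, so \<open>T\<^sup>2\<close> is not defined at \<open>1/k\<close>.\<close>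

definition markov_renyi :: "(real \<Rightarrow> real) \<Rightarrow> (nat \<Rightarrow> real set) \<Rightarrow> real \<Rightarrow> bool" where
  "markov_renyi T J \<gamma> \<longleftrightarrow>
     (\<forall>n\<ge>1. open (J n) \<and> is_interval (J n) \<and> J n \<noteq> {} \<and> J n \<subseteq> {0..1}) \<and>
     disjoint_family_on J {1..} \<and>
     T ` I_star J \<subseteq> {0..1} \<and>
     (\<forall>n\<ge>1. is_singleton (frontier (J n) \<inter> frontier (J (Suc n)))) \<and>
     (\<exists>p m. p \<in> I_star J \<and> m \<ge> 1 \<and> T p = p \<and>
        (\<exists>d. iter_deriv (I_star J) T 1 p d \<and> \<bar>d\<bar> \<ge> 1) \<and>
        (\<forall>x \<in> I_star J - {p}. \<forall>S \<in> {{..x}, {x..}}. \<forall>d.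
           iter_deriv_on S (I_star J) T m x d \<longrightarrow> \<bar>d\<bar> > 1)) \<and>
     (\<forall>n\<ge>1. closure (T ` J n) = {0..1}) \<and>
     \<gamma> > 1 \<and>
     (\<exists>Tn. (\<forall>n\<ge>1. (\<exists>U. closure (J n) \<subseteq> U \<and> C1_diffeo_on (Tn n) U) \<and>
                  (\<forall>x\<in>J n. Tn n x = T x)) \<and>
           (\<exists>C>1. \<forall>n\<ge>1. \<forall>x\<in>closure (J n).
               inverse C * real n powr \<gamma> \<le> \<bar>deriv (Tn n) x\<bar> \<and>
               \<bar>deriv (Tn n) x\<bar> \<le> C * real n powr \<gamma>))"

definition exceptional_set :: "(real \<Rightarrow> real) \<Rightarrow> (nat \<Rightarrow> real set) \<Rightarrow> real set" where
  "exceptional_set T J =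
     (\<Union>k. iter_preimage (I_star J) T k ({0, 1} \<union> (\<Union>n\<in>{1..}. frontier (J n))))"

definition limit_set :: "(real \<Rightarrow> real) \<Rightarrow> (nat \<Rightarrow> real set) \<Rightarrow> real set" where
  "limit_set T J = I_star J - exceptional_set T J"


section \<open>Lyapunov exponents\<close>

text \<open>The limit is taken in the extended reals, with \<open>log 0 = -\<infinity>\<close>.\<close>

definition has_lyapunov_exponent ::
  "(real \<Rightarrow> real) \<Rightarrow> (nat \<Rightarrow> real set) \<Rightarrow> real \<Rightarrow> ereal \<Rightarrow> bool" where
  "has_lyapunov_exponent T J x l \<longleftrightarrow>
     (\<exists>d. (\<forall>n\<ge>1. iter_deriv (I_star J) T n x (d n)) \<and>
          (\<lambda>n. if d n = 0 then -\<infinity> else ereal (1 / real n * ln \<bar>d n\<bar>)) \<longlonglongrightarrow> l)"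

definition lyapunov_level_set ::
  "(real \<Rightarrow> real) \<Rightarrow> (nat \<Rightarrow> real set) \<Rightarrow> ereal \<Rightarrow> real set" where
  "lyapunov_level_set T J l = {x \<in> {0..1}. has_lyapunov_exponent T J x l}"

definition lyapunov_spectrum ::
  "(real \<Rightarrow> real) \<Rightarrow> (nat \<Rightarrow> real set) \<Rightarrow> ereal \<Rightarrow> ereal" where
  "lyapunov_spectrum T J l = hausdorff_dim (lyapunov_level_set T J l)"

end

theory Submission
  imports Defs "HOL-Probability.Probability"
begin

text \<open>Since \<open>|T'|\<close> is comparable to \<open>b\<^sup>\<gamma>\<close> on \<open>J b\<close>, a point has Lyapunov exponent \<open>\<infinity>\<close> iff the means
  of the logarithms of its digits tend to \<open>\<infinity>\<close>, up to the countable exceptional set. No distortion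
  estimate is available (the branches are only \<open>C\<^sup>1\<close>), but a loss of \<open>C\<^sup>n\<close> at order \<open>n\<close> is harmless
  when the digits are that large.

  Upper bound: cover by the cylinders of order \<open>n\<close>, whose diameters are at most
  \<open>\<Prod>j<n. C * b\<^sub>j powr -\<gamma>\<close>. Lower bound: let the \<open>j\<close>-th digit run uniformly and independently
  through \<open>j + 1\<close> consecutive numbers of size about \<open>j\<close>. A cylinder of order \<open>n\<close> has mass \<open>1 / n!\<close>
  and length at least \<open>c\<^sup>n * (n!) powr -\<gamma>\<close>, and disjoint intervals of length at least \<open>l\<close> that meet a
  set of diameter \<open>r\<close> number at most \<open>r / l + 2\<close>, so the mass distribution principle applies.\<close>

section \<open>Hausdorff measure\<close>

text \<open>For \<open>s > 0\<close> a small sum forces small diameters: a total of at most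
  \<open>\<delta> powr s\<close> bounds every single term, hence every diameter by
  \<open>\<delta>\<close>. So covers without a mesh restriction decide nullity.\<close>

lemma hausdorff_measure_eq_0I:
  assumes "0 < s"
    and cover: "\<And>\<epsilon>. 0 < \<epsilon> \<Longrightarrow>
      \<exists>U. E \<subseteq> (\<Union>i. U i) \<and> (\<forall>i. bounded (U i)) \<and> (\<Sum>i. diam_weight s (U i)) \<le> ennreal \<epsilon>"
  shows "hausdorff_measure s E = 0"
proof -
  have *: "hausdorff_premeasure s \<delta> E \<le> 0 + ennreal \<epsilon>" if "0 < \<delta>" "0 < \<epsilon>" for \<delta> \<epsilon> :: real
  proof -
    define \<epsilon>' where "\<epsilon>' = min \<epsilon> (\<delta> powr s)"
    have "0 < \<epsilon>'" using that by (simp add: \<epsilon>'_def)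
    from cover[OF this] obtain U where U: "E \<subseteq> (\<Union>i. U i)" "\<And>i. bounded (U i)"
      "(\<Sum>i. diam_weight s (U i)) \<le> ennreal \<epsilon>'" by blast
    have "diameter (U i) \<le> \<delta>" for i
    proof (rule ccontr)
      assume less: "\<not> diameter (U i) \<le> \<delta>"
      then have "U i \<noteq> {}" using that by (auto simp: diameter_def)
      have "diam_weight s (U i) \<le> (\<Sum>i. diam_weight s (U i))"
        using sum_le_suminf[of "\<lambda>i. diam_weight s (U i)" "{i}"] by simp
      also have "\<dots> \<le> ennreal (\<delta> powr s)"
        using U(3) by (rule order_trans) (auto simp: \<epsilon>'_def intro: ennreal_leI)
      finally have "diameter (U i) powr s \<le> \<delta> powr s"
        using \<open>U i \<noteq> {}\<close> \<open>0 < s\<close> by (simp add: diam_weight_def)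
      moreover have "\<delta> powr s < diameter (U i) powr s"
        using less that \<open>0 < s\<close> by (intro powr_less_mono2) auto
      ultimately show False by simp
    qed
    then have "hausdorff_premeasure s \<delta> E \<le> (\<Sum>i. diam_weight s (U i))"
      unfolding hausdorff_premeasure_def using U by (intro INF_lower) auto
    also have "\<dots> \<le> ennreal \<epsilon>"
      using U(3) by (rule order_trans) (auto simp: \<epsilon>'_def intro: ennreal_leI)
    finally show ?thesis by simp
  qed
  have "hausdorff_premeasure s \<delta> E \<le> 0" if "0 < \<delta>" for \<delta>
    by (rule ennreal_le_epsilon) (rule *[OF that])
  then have "hausdorff_measure s E \<le> 0"
    unfolding hausdorff_measure_def by (intro SUP_least) simp
  then show ?thesis by simp
qed

lemma hausdorff_measure_eq_0D:
  assumes "hausdorff_measure s E = 0" "0 < \<epsilon>" "0 < \<delta>"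
  shows "\<exists>U. E \<subseteq> (\<Union>i. U i) \<and> (\<forall>i. bounded (U i) \<and> diameter (U i) \<le> \<delta>) \<and>
    (\<Sum>i. diam_weight s (U i)) < ennreal \<epsilon>"
proof -
  have "hausdorff_premeasure s \<delta> E \<le> hausdorff_measure s E"
    unfolding hausdorff_measure_def using assms by (intro SUP_upper) auto
  then have "hausdorff_premeasure s \<delta> E < ennreal \<epsilon>" using assms by simp
  then show ?thesis unfolding hausdorff_premeasure_def by (auto simp: INF_less_iff)
qed

lemma hausdorff_measure_mono:
  assumes "E \<subseteq> F" shows "hausdorff_measure s E \<le> hausdorff_measure s F"
proof -
  have "hausdorff_premeasure s \<delta> E \<le> hausdorff_premeasure s \<delta> F" for \<delta>
    unfolding hausdorff_premeasure_def by (rule INF_superset_mono) (use assms in auto)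
  then show ?thesis unfolding hausdorff_measure_def by (rule SUP_mono')
qed

lemma hausdorff_measure_UN_eq_0:
  fixes E :: "nat \<Rightarrow> 'a::metric_space set"
  assumes "0 < s" and null: "\<And>n. hausdorff_measure s (E n) = 0"
  shows "hausdorff_measure s (\<Union>n. E n) = 0"
proof (rule hausdorff_measure_eq_0I[OF \<open>0 < s\<close>])
  fix \<epsilon> :: real assume "0 < \<epsilon>"
  have "\<exists>U. E n \<subseteq> (\<Union>i. U i) \<and> (\<forall>i. bounded (U i) \<and> diameter (U i) \<le> 1) \<and>
    (\<Sum>i. diam_weight s (U i)) < ennreal (\<epsilon> * (1/2) ^ Suc n)" for n
    using \<open>0 < \<epsilon>\<close> by (intro hausdorff_measure_eq_0D null) auto
  then obtain U where U: "\<And>n. E n \<subseteq> (\<Union>i. U n i)" "\<And>n i. bounded (U n i)"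
    "\<And>n. (\<Sum>i. diam_weight s (U n i)) < ennreal (\<epsilon> * (1/2) ^ Suc n)"
    by metis
  let ?V = "\<lambda>k. case_prod U (prod_decode k)"
  have "(\<Union>n. E n) \<subseteq> (\<Union>k. ?V k)"
  proof
    fix x assume "x \<in> (\<Union>n. E n)"
    then obtain n i where "x \<in> U n i" using U(1) by blast
    then have "x \<in> ?V (prod_encode (n, i))" by simp
    then show "x \<in> (\<Union>k. ?V k)" by (rule UN_I[OF UNIV_I])
  qed
  moreover have "bounded (?V k)" for k
    by (cases "prod_decode k") (simp add: U)
  moreover have "(\<Sum>k. diam_weight s (?V k)) \<le> ennreal \<epsilon>"
  proof -
    have "(\<Sum>k. diam_weight s (?V k)) = (\<Sum>n. \<Sum>i. diam_weight s (U n i))"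
      using suminf_ennreal_2dimen[of "\<lambda>n. \<Sum>i. diam_weight s (U n i)"
          "\<lambda>p. diam_weight s (case_prod U p)"]
      by simp
    also have "\<dots> \<le> (\<Sum>n. ennreal (\<epsilon> * (1/2) ^ Suc n))"
      using U(3) by (intro suminf_le) (auto intro: less_imp_le)
    also have "\<dots> = ennreal \<epsilon>"
      using \<open>0 < \<epsilon>\<close> sums_mult[OF power_half_series, of \<epsilon>]
      by (intro suminf_ennreal_eq) auto
    finally show ?thesis .
  qed
  ultimately show "\<exists>U. (\<Union>n. E n) \<subseteq> (\<Union>i. U i) \<and> (\<forall>i. bounded (U i)) \<and>
      (\<Sum>i. diam_weight s (U i)) \<le> ennreal \<epsilon>"
    by (intro exI[of _ ?V]) auto
qed

lemma hausdorff_measure_Un_eq_0: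
  assumes "0 < s" "hausdorff_measure s E = 0" "hausdorff_measure s F = 0"
  shows "hausdorff_measure s (E \<union> F) = 0"
proof -
  have "E \<union> F = (\<Union>n::nat. if n = 0 then E else F)" by (auto split: if_splits)
  then show ?thesis
    using hausdorff_measure_UN_eq_0[of s "\<lambda>n. if n = 0 then E else F"] assms by simp
qed

lemma hausdorff_measure_singleton:
  assumes "0 < s" shows "hausdorff_measure s {x} = 0"
  using assms
  by (rule hausdorff_measure_eq_0I) (rule exI[of _ "\<lambda>_. {x}"], use assms in \<open>simp add: diam_weight_def\<close>)

lemma hausdorff_measure_countable:
  fixes E :: "'a::metric_space set"
  assumes "0 < s" "countable E" shows "hausdorff_measure s E = 0"
proof (cases "E = {}")
  case True
  then show ?thesis
    using hausdorff_measure_mono[of E "{undefined :: 'a}" s] hausdorff_measure_singleton[OF \<open>0 < s\<close>, of "undefined :: 'a"]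
    by simp
next
  case False
  then have "E = (\<Union>n. {from_nat_into E n})"
    using range_from_nat_into[OF False \<open>countable E\<close>] by auto
  then show ?thesis
    using hausdorff_measure_UN_eq_0[of s "\<lambda>n. {from_nat_into E n}"] assms hausdorff_measure_singleton by metis
qed

lemma hausdorff_dim_eqI:
  assumes "0 < d"
    and null: "\<And>s. d < s \<Longrightarrow> hausdorff_measure s E = 0"
    and pos: "\<And>s. 0 < s \<Longrightarrow> s < d \<Longrightarrow> hausdorff_measure s E \<noteq> 0"
  shows "hausdorff_dim E = ereal d"
proof -
  \<comment> \<open>At \<open>s = 0\<close> the weights count nonempty sets, so a total below 1
    makes the cover and hence \<open>E\<close> empty; but \<open>pos\<close> at \<open>d/2\<close>
    excludes the empty set.\<close>
  have zero: "hausdorff_measure 0 E \<noteq> 0"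
  proof
    assume "hausdorff_measure 0 E = 0"
    from hausdorff_measure_eq_0D[OF this, of 1 1] obtain U where U: "E \<subseteq> (\<Union>i. U i)"
      "(\<Sum>i. diam_weight 0 (U i)) < 1" by auto
    have "U i = {}" for i
    proof (rule ccontr)
      assume "U i \<noteq> {}"
      then have "1 \<le> (\<Sum>i. diam_weight 0 (U i))"
        using sum_le_suminf[of "\<lambda>i. diam_weight 0 (U i)" "{i}"] by (simp add: diam_weight_def)
      then show False using U(2) by simp
    qed
    then have "E = {}" using U(1) by auto
    moreover have "E \<noteq> {}"
      using hausdorff_measure_countable[of "d/2" E] pos[of "d/2"] \<open>0 < d\<close> by auto
    ultimately show False by simp
  qed
  have "ereal d \<le> hausdorff_dim E"
    unfolding hausdorff_dim_def
  proof (rule INF_greatest)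
    fix s assume "s \<in> {s. 0 \<le> s \<and> hausdorff_measure s E = 0}"
    then show "ereal d \<le> ereal s"
      using pos[of s] zero by (cases "s = 0") (auto simp: not_less[symmetric])
  qed
  moreover have "hausdorff_dim E \<le> ereal d"
  proof (rule ereal_le_epsilon2)
    fix e :: real assume "0 < e"
    then have "d + e \<in> {s. 0 \<le> s \<and> hausdorff_measure s E = 0}"
      using null[of "d + e"] \<open>0 < d\<close> by simp
    then show "hausdorff_dim E \<le> ereal d + ereal e"
      unfolding hausdorff_dim_def by (rule INF_lower2) simp
  qed
  ultimately show ?thesis by (rule antisym[rotated])
qed

section \<open>Sums over words and counting of disjoint intervals\<close>

text \<open>The distributive law for a power of a series, with all words enumerated through
  \<open>list_decode\<close>; it sums weights over the cylinders of order \<open>n\<close>.\<close>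

lemma suminf_list_prod:
  fixes g :: "nat \<Rightarrow> ennreal"
  shows "(\<Sum>k. let w = list_decode k in if length w = n then \<Prod>b\<leftarrow>w. g b else 0) = (\<Sum>b. g b) ^ n"
proof (induction n)
  case 0
  have "(\<lambda>k. let w = list_decode k in if length w = 0 then \<Prod>b\<leftarrow>w. g b else 0) =
    (\<lambda>k. if k = 0 then 1 else 0)"
  proof
    fix k
    show "(let w = list_decode k in if length w = 0 then \<Prod>b\<leftarrow>w. g b else 0) = (if k = 0 then 1 else 0)"
      by (cases k) (auto simp: Let_def split: prod.splits)
  qed
  then show ?case
    using suminf_finite[of "{0::nat}" "\<lambda>k. if k = 0 then 1 else (0::ennreal)"] by simp
next
  case (Suc n)
  let ?F = "\<lambda>n w. if length w = n then \<Prod>b\<leftarrow>w. g b else 0"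
  define f where "f k = ?F (Suc n) (list_decode k)" for k
  \<comment> \<open>Code 0 is the empty word, whose length is not \<open>Suc n\<close>; code
    \<open>Suc k\<close> is the word with head \<open>b\<close> and tail coded by \<open>m\<close>,
    where \<open>(b, m)\<close> is \<open>prod_decode k\<close>.\<close>
  have "(\<Sum>k. f k) = (\<Sum>k. f (Suc k))"
    using suminf_offset[of f 1] by (simp add: f_def[of 0])
  also have "\<dots> = (\<Sum>k. case prod_decode k of (b, m) \<Rightarrow> g b * ?F n (list_decode m))"
    unfolding f_def by (intro arg_cong[of _ _ suminf] ext) (auto split: prod.splits)
  also have "\<dots> = (\<Sum>b. \<Sum>m. g b * ?F n (list_decode m))"
    using suminf_ennreal_2dimen[of "\<lambda>b. \<Sum>m. g b * ?F n (list_decode m)"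
        "\<lambda>(b, m). g b * ?F n (list_decode m)"] by simp
  also have "\<dots> = (\<Sum>b. g b) * (\<Sum>b. g b) ^ n"
    using Suc by (simp add: Let_def)
  finally show ?case by (simp add: Let_def f_def)
qed

text \<open>Each \<open>C w\<close> contains an interval of length exactly \<open>l\<close> inside
  \<open>{p - l..q + l}\<close>; these are disjoint, so comparing Lebesgue measures gives the
  bound.\<close>

lemma card_intervals_le:
  fixes C :: "'i \<Rightarrow> real set" and l p q :: real
  assumes "finite W" "disjoint_family_on C W" "0 < l" "p \<le> q"
    and "\<And>w. w \<in> W \<Longrightarrow> is_interval (C w)"
    and meets: "\<And>w. w \<in> W \<Longrightarrow> C w \<inter> {p..q} \<noteq> {}"
    and long: "\<And>w. w \<in> W \<Longrightarrow> \<exists>y\<in>C w. \<exists>z\<in>C w. l \<le> z - y"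
  shows "card W * l \<le> q - p + 2 * l"
proof -
  have "\<exists>u v. {u..v} \<subseteq> C w \<inter> {p - l..q + l} \<and> l = v - u" if "w \<in> W" for w
  proof -
    from long[OF that] obtain y z where yz: "y \<in> C w" "z \<in> C w" "l \<le> z - y" by auto
    from meets[OF that] obtain c where c: "c \<in> C w" "p \<le> c" "c \<le> q" by auto
    have sub: "{u..v} \<subseteq> C w" if "u \<in> C w" "v \<in> C w" for u v
      using assms(5)[OF \<open>w \<in> W\<close>] that unfolding is_interval_1 by (meson atLeastAtMost_iff subsetI)
    \<comment> \<open>Either \<open>C w\<close> reaches by \<open>l\<close> to the right of the
      common point \<open>c\<close>, or to its left, or \<open>y\<close> and \<open>z\<close> both
      lie within \<open>l\<close> of \<open>c\<close>.\<close>
    consider "c + l \<le> z" | "y \<le> c - l" | "z < c + l" "c - l < y" by linarith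
    then show ?thesis
    proof cases
      case 1
      then show ?thesis
        using sub[OF c(1) yz(2)] c \<open>0 < l\<close> by (intro exI[of _ c] exI[of _ "c + l"]) auto
    next
      case 2
      then show ?thesis
        using sub[OF yz(1) c(1)] c \<open>0 < l\<close> by (intro exI[of _ "c - l"] exI[of _ c]) auto
    next
      case 3
      then show ?thesis
        using sub[OF yz(1,2)] c yz(3) \<open>0 < l\<close> by (intro exI[of _ y] exI[of _ "y + l"]) auto
    qed
  qed
  then obtain u v where uv: "\<And>w. w \<in> W \<Longrightarrow> {u w..v w} \<subseteq> C w \<inter> {p - l..q + l}"
    "\<And>w. w \<in> W \<Longrightarrow> l = v w - u w"
    by metis
  have "(\<Sum>w\<in>W. emeasure lborel {u w..v w}) = emeasure lborel (\<Union>w\<in>W. {u w..v w})"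
  proof (rule sum_emeasure)
    have "{u w..v w} \<inter> {u w'..v w'} = {}" if "w \<in> W" "w' \<in> W" "w \<noteq> w'" for w w'
      using uv(1)[OF that(1)] uv(1)[OF that(2)] assms(2) that unfolding disjoint_family_on_def
      by blast
    then show "disjoint_family_on (\<lambda>w. {u w..v w}) W" by (simp add: disjoint_family_on_def)
  qed (use assms(1) in auto)
  also have "\<dots> \<le> emeasure lborel {p - l..q + l}"
    using uv(1) by (intro emeasure_mono UN_least) (blast, simp)
  also have "\<dots> = ennreal (q - p + 2 * l)"
    using assms(3,4) by simp
  also have "(\<Sum>w\<in>W. emeasure lborel {u w..v w}) = (\<Sum>w\<in>W. ennreal l)"
  proof (rule sum.cong)
    fix w assume "w \<in> W"
    from uv(2)[OF this] show "emeasure lborel {u w..v w} = ennreal l" using \<open>0 < l\<close> by simp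
  qed simp
  also have "\<dots> = ennreal (card W * l)"
    using \<open>0 < l\<close> by (simp add: ennreal_mult ennreal_of_nat_eq_real_of_nat)
  finally show ?thesis
    using assms(3,4) by (subst (asm) ennreal_le_iff) auto
qed

section \<open>Cylinders of full branches\<close>

text \<open>What the dimension argument uses of a Markov--Renyi map. The bounds concern
  \<open>T\<close> itself on the open branches rather than extensions, and the image of a branch is
  exactly the open unit interval.\<close>

locale full_branches =
  fixes T :: "real \<Rightarrow> real" and J :: "nat \<Rightarrow> real set" and \<gamma> C :: real
  assumes gamma: "1 < \<gamma>" and C: "1 < C"
    and branch_open: "\<And>b. 1 \<le> b \<Longrightarrow> open (J b)"
    and branch_interval: "\<And>b. 1 \<le> b \<Longrightarrow> is_interval (J b)"
    and branch_subset: "\<And>b. 1 \<le> b \<Longrightarrow> J b \<subseteq> {0..1}"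
    and branch_disjoint: "disjoint_family_on J {1..}"
    and branch_image: "\<And>b. 1 \<le> b \<Longrightarrow> T ` J b = {0<..<1}"
    and branch_differentiable: "\<And>b x. 1 \<le> b \<Longrightarrow> x \<in> J b \<Longrightarrow> T differentiable at x"
    and branch_deriv_lower: "\<And>b x. 1 \<le> b \<Longrightarrow> x \<in> J b \<Longrightarrow> inverse C * real b powr \<gamma> \<le> \<bar>deriv T x\<bar>"
    and branch_deriv_upper: "\<And>b x. 1 \<le> b \<Longrightarrow> x \<in> J b \<Longrightarrow> \<bar>deriv T x\<bar> \<le> C * real b powr \<gamma>"
begin

lemma branch_DERIV: "1 \<le> b \<Longrightarrow> x \<in> J b \<Longrightarrow> (T has_real_derivative deriv T x) (at x)"
  using branch_differentiable DERIV_deriv_iff_real_differentiable by blast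

lemma branch_subset_open:
  assumes "1 \<le> b" shows "J b \<subseteq> {0<..<1}"
  using interior_mono[OF branch_subset[OF assms]] interior_open[OF branch_open[OF assms]] by simp

lemma branch_mean_value:
  assumes "1 \<le> b" "x \<in> J b" "y \<in> J b"
  shows "\<exists>z\<in>J b. \<bar>T x - T y\<bar> = \<bar>deriv T z\<bar> * \<bar>x - y\<bar>"
proof -
  have *: "\<exists>z\<in>J b. \<bar>T x - T y\<bar> = \<bar>deriv T z\<bar> * \<bar>x - y\<bar>" if "x < y" "x \<in> J b" "y \<in> J b" for x y
  proof -
    have sub: "z \<in> J b" if "x \<le> z" "z \<le> y" for z
      using branch_interval[OF \<open>1 \<le> b\<close>] \<open>x \<in> J b\<close> \<open>y \<in> J b\<close> that unfolding is_interval_1 by blast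
    obtain z where "x < z" "z < y" "T y - T x = (y - x) * deriv T z"
      using MVT2[of x y T "deriv T"] \<open>x < y\<close> branch_DERIV[OF \<open>1 \<le> b\<close> sub] by blast
    then show ?thesis
      using sub[of z] \<open>x < y\<close> abs_minus_commute[of "T x" "T y"]
      by (intro bexI[of _ z]) (auto simp: abs_mult mult.commute)
  qed
  consider "x < y" | "x = y" | "y < x" by linarith
  then show ?thesis
  proof cases
    case 1 then show ?thesis using * assms by blast
  next
    case 2 then show ?thesis using assms by auto
  next
    case 3 then show ?thesis using *[of y x] assms by (simp add: abs_minus_commute)
  qed
qed

lemma branch_expand_upper:
  assumes "1 \<le> b" "x \<in> J b" "y \<in> J b"
  shows "\<bar>T x - T y\<bar> \<le> C * real b powr \<gamma> * \<bar>x - y\<bar>"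
  using branch_mean_value[OF assms] branch_deriv_upper[OF assms(1)]
  by (metis abs_ge_zero mult_right_mono)

text \<open>Mean value theorem with the lower derivative bound; it yields injectivity of
  \<open>T\<close> on a branch and the Lipschitz bound for the inverse.\<close>

lemma branch_expand_lower:
  assumes "1 \<le> b" "x \<in> J b" "y \<in> J b"
  shows "\<bar>x - y\<bar> \<le> C * real b powr (- \<gamma>) * \<bar>T x - T y\<bar>"
proof -
  obtain z where z: "z \<in> J b" "\<bar>T x - T y\<bar> = \<bar>deriv T z\<bar> * \<bar>x - y\<bar>"
    using branch_mean_value[OF assms] by blast
  have "\<bar>x - y\<bar> = C * real b powr (- \<gamma>) * (inverse C * real b powr \<gamma> * \<bar>x - y\<bar>)"
    using C assms(1) by (simp add: powr_minus field_simps)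
  also have "\<dots> \<le> C * real b powr (- \<gamma>) * (\<bar>deriv T z\<bar> * \<bar>x - y\<bar>)"
    using C branch_deriv_lower[OF assms(1) z(1)] by (intro mult_left_mono mult_right_mono) auto
  finally show ?thesis using z(2) by simp
qed

lemma branch_inj: assumes "1 \<le> b" shows "inj_on T (J b)"
proof (rule inj_onI)
  fix x y assume "x \<in> J b" "y \<in> J b" "T x = T y"
  then show "x = y" using branch_expand_lower[OF assms, of x y] by simp
qed

lemma branch_unique: "1 \<le> b \<Longrightarrow> 1 \<le> c \<Longrightarrow> x \<in> J b \<Longrightarrow> x \<in> J c \<Longrightarrow> b = c"
  using branch_disjoint unfolding disjoint_family_on_def by (metis IntI atLeast_iff empty_iff)

section \<open>Digits, cylinders and their lengths\<close>

text \<open>Nothing is assumed about \<open>J 0\<close>, so codes have to avoid the digit 0.\<close>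

definition digits :: "(nat \<Rightarrow> nat) \<Rightarrow> bool" where
  "digits a \<longleftrightarrow> (\<forall>j. 1 \<le> a j)"

lemma digitsD: "digits a \<Longrightarrow> 1 \<le> a j"
  by (simp add: digits_def)

text \<open>Only the values of \<open>a\<close> below \<open>n\<close> matter, so finite words and
  infinite codes share the definition. Requiring \<open>x\<close> in \<open>{0<..<1}\<close> fixes
  the cylinder of order 0.\<close>

definition cyl :: "(nat \<Rightarrow> nat) \<Rightarrow> nat \<Rightarrow> real set" where
  "cyl a n = {x \<in> {0<..<1}. \<forall>j<n. (T ^^ j) x \<in> J (a j)}"

lemma cyl_0 [simp]: "cyl a 0 = {0<..<1}"
  by (auto simp: cyl_def)

lemma cyl_Suc: "cyl a (Suc n) = {x \<in> cyl a n. (T ^^ n) x \<in> J (a n)}"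
  by (auto simp: cyl_def less_Suc_eq)

definition coded :: "(nat \<Rightarrow> nat) \<Rightarrow> real \<Rightarrow> bool" where
  "coded a x \<longleftrightarrow> digits a \<and> (\<forall>j. (T ^^ j) x \<in> J (a j))"

lemma codedD: "coded a x \<Longrightarrow> 1 \<le> a j" "coded a x \<Longrightarrow> (T ^^ j) x \<in> J (a j)"
  by (auto simp: coded_def digits_def)

lemma coded_cyl: assumes "coded a x" shows "x \<in> cyl a n"
  using codedD[OF assms] codedD[OF assms, of 0] branch_subset_open by (fastforce simp: cyl_def)

text \<open>Digits are constrained only below \<open>n\<close>, because cylinders are later also
  indexed by \<open>(!) w\<close> for a list \<open>w\<close> of length \<open>n\<close>.\<close>

lemma cyl_image_bounds:
  assumes "\<And>j. j < n \<Longrightarrow> 1 \<le> a j" "x \<in> cyl a n" shows "(T ^^ n) x \<in> {0<..<1}"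
proof (cases n)
  case 0
  then show ?thesis using assms by simp
next
  case (Suc m)
  then show ?thesis using assms branch_image[of "a m"] by (auto simp: cyl_Suc)
qed

text \<open>Points of a common cylinder share a branch at every step, so the one-step bounds
  multiply along the orbit.\<close>

lemma cyl_expand_upper:
  assumes "\<And>j. j < n \<Longrightarrow> 1 \<le> a j" "x \<in> cyl a n" "y \<in> cyl a n"
  shows "\<bar>(T ^^ n) x - (T ^^ n) y\<bar> \<le> (\<Prod>j<n. C * real (a j) powr \<gamma>) * \<bar>x - y\<bar>"
  using assms
proof (induction n)
  case (Suc n)
  then have "\<bar>(T ^^ Suc n) x - (T ^^ Suc n) y\<bar>
      \<le> C * real (a n) powr \<gamma> * \<bar>(T ^^ n) x - (T ^^ n) y\<bar>"
    by (simp add: cyl_Suc branch_expand_upper)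
  also have "\<dots> \<le> C * real (a n) powr \<gamma> * ((\<Prod>j<n. C * real (a j) powr \<gamma>) * \<bar>x - y\<bar>)"
    using Suc C by (intro mult_left_mono) (auto simp: cyl_Suc)
  finally show ?case by (simp add: algebra_simps)
qed simp

lemma cyl_expand_lower:
  assumes "\<And>j. j < n \<Longrightarrow> 1 \<le> a j" "x \<in> cyl a n" "y \<in> cyl a n"
  shows "\<bar>x - y\<bar> \<le> (\<Prod>j<n. C * real (a j) powr (- \<gamma>)) * \<bar>(T ^^ n) x - (T ^^ n) y\<bar>"
  using assms
proof (induction n)
  case (Suc n)
  then have "\<bar>x - y\<bar> \<le> (\<Prod>j<n. C * real (a j) powr (- \<gamma>)) * \<bar>(T ^^ n) x - (T ^^ n) y\<bar>"
    by (simp add: cyl_Suc)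
  also have "\<dots> \<le> (\<Prod>j<n. C * real (a j) powr (- \<gamma>)) *
      (C * real (a n) powr (- \<gamma>) * \<bar>(T ^^ Suc n) x - (T ^^ Suc n) y\<bar>)"
    using Suc C by (intro mult_left_mono prod_nonneg) (auto simp: cyl_Suc branch_expand_lower)
  finally show ?case by (simp add: algebra_simps)
qed simp

lemma cyl_diameter:
  assumes "\<And>j. j < n \<Longrightarrow> 1 \<le> a j"
  shows "diameter (cyl a n) \<le> (\<Prod>j<n. C * real (a j) powr (- \<gamma>))"
proof (rule diameter_le)
  show "cyl a n \<noteq> {} \<or> 0 \<le> (\<Prod>j<n. C * real (a j) powr (- \<gamma>))"
    using C by (auto intro!: prod_nonneg)
  fix x y assume xy: "x \<in> cyl a n" "y \<in> cyl a n"
  have "norm (x - y) \<le> (\<Prod>j<n. C * real (a j) powr (- \<gamma>)) * \<bar>(T ^^ n) x - (T ^^ n) y\<bar>"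
    using cyl_expand_lower[OF assms xy] by simp
  also have "\<dots> \<le> (\<Prod>j<n. C * real (a j) powr (- \<gamma>)) * 1"
    using cyl_image_bounds[OF assms xy(1)] cyl_image_bounds[OF assms xy(2)] C
    by (intro mult_left_mono prod_nonneg) auto
  finally show "norm (x - y) \<le> (\<Prod>j<n. C * real (a j) powr (- \<gamma>))" by simp
qed

section \<open>Inverse branches and coded points\<close>

definition inv_branch :: "nat \<Rightarrow> real \<Rightarrow> real" where
  "inv_branch b = inv_into (J b) T"

text \<open>The digit \<open>a (n - 1)\<close> is inverted first and \<open>a 0\<close> last, so for
  admissible digits this is the inverse of \<open>T ^^ n\<close> on \<open>cyl a n\<close>.\<close>

primrec inv_branches :: "(nat \<Rightarrow> nat) \<Rightarrow> nat \<Rightarrow> real \<Rightarrow> real" where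
  "inv_branches a 0 y = y"
| "inv_branches a (Suc n) y = inv_branches a n (inv_branch (a n) y)"

lemma inv_branch:
  assumes "1 \<le> b" "y \<in> {0<..<1}"
  shows "inv_branch b y \<in> J b" "T (inv_branch b y) = y"
  using assms branch_image[OF assms(1)] unfolding inv_branch_def
  by (metis inv_into_into, metis f_inv_into_f)

lemma inv_branch_T: "1 \<le> b \<Longrightarrow> x \<in> J b \<Longrightarrow> inv_branch b (T x) = x"
  unfolding inv_branch_def by (intro inv_into_f_f branch_inj)

lemma continuous_inv_branch:
  assumes "1 \<le> b" shows "continuous_on {0<..<1} (inv_branch b)"
proof (rule lipschitz_on_continuous_on, rule lipschitz_onI)
  fix x y :: real assume "x \<in> {0<..<1}" "y \<in> {0<..<1}"
  then show "dist (inv_branch b x) (inv_branch b y) \<le> C * real b powr (- \<gamma>) * dist x y"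
    using branch_expand_lower[OF assms inv_branch(1)[OF assms] inv_branch(1)[OF assms], of x y]
    by (simp add: inv_branch(2)[OF assms] dist_real_def)
qed (use C in auto)

lemma inv_branches:
  assumes "digits a" "y \<in> {0<..<1}"
  shows "inv_branches a n y \<in> cyl a n" "(T ^^ n) (inv_branches a n y) = y"
proof -
  have "inv_branches a n y \<in> cyl a n \<and> (T ^^ n) (inv_branches a n y) = y"
    using assms(2)
  proof (induction n arbitrary: y)
    case (Suc n)
    have *: "inv_branch (a n) y \<in> J (a n)" "T (inv_branch (a n) y) = y"
      using inv_branch[OF digitsD[OF assms(1)] Suc.prems] by auto
    then have "inv_branch (a n) y \<in> {0<..<1}"
      using branch_subset_open[OF digitsD[OF assms(1)]] by blast
    from Suc.IH[OF this] * show ?case by (simp add: cyl_Suc)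
  qed simp
  then show "inv_branches a n y \<in> cyl a n" "(T ^^ n) (inv_branches a n y) = y" by auto
qed

lemma inv_branches_iterate:
  assumes "digits a" "x \<in> cyl a n"
  shows "inv_branches a n ((T ^^ n) x) = x"
  using assms(2) by (induction n) (auto simp: cyl_Suc inv_branch_T[OF digitsD[OF assms(1)]])

text \<open>This presentation gives connectedness: a cylinder is a continuous image of an
  interval.\<close>

lemma cyl_eq_image:
  assumes "digits a" shows "cyl a n = inv_branches a n ` {0<..<1}"
proof (intro equalityI subsetI)
  fix x assume "x \<in> cyl a n"
  then show "x \<in> inv_branches a n ` {0<..<1}"
    using inv_branches_iterate[OF assms, of x n] cyl_image_bounds[of n a x] digitsD[OF assms] by (metis image_eqI)
qed (use inv_branches[OF assms] in auto)

lemma continuous_inv_branches: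
  assumes "digits a" shows "continuous_on {0<..<1} (inv_branches a n)"
proof (induction n)
  case (Suc n)
  have "inv_branch (a n) ` {0<..<1} \<subseteq> {0<..<1}"
    using inv_branch(1)[OF digitsD[OF assms]] branch_subset_open[OF digitsD[OF assms]] by blast
  then have "continuous_on {0<..<1} (\<lambda>y. inv_branches a n (inv_branch (a n) y))"
    by (intro continuous_on_compose2[OF Suc continuous_inv_branch[OF digitsD[OF assms]]])
  then show ?case by simp
qed simp

lemma is_interval_cyl:
  assumes "digits a" shows "is_interval (cyl a n)"
  unfolding is_interval_connected_1 cyl_eq_image[OF assms]
  by (intro connected_continuous_image continuous_inv_branches[OF assms]) simp

text \<open>Pull back 1/4 and 3/4: their images under \<open>T ^^ n\<close> are 1/2 apart, and the
  expansion is at most the product.\<close>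

lemma cyl_long:
  assumes "digits a"
  shows "\<exists>y\<in>cyl a n. \<exists>z\<in>cyl a n. inverse (2 * (\<Prod>j<n. C * real (a j) powr \<gamma>)) \<le> z - y"
proof -
  define P where "P = (\<Prod>j<n. C * real (a j) powr \<gamma>)"
  have "0 < C * real (a j) powr \<gamma>" for j
    using C digitsD[OF assms, of j] by simp
  then have "0 < P" unfolding P_def by (intro prod_pos) auto
  let ?y = "inv_branches a n (1/4)" and ?z = "inv_branches a n (3/4)"
  have y: "?y \<in> cyl a n" "(T ^^ n) ?y = 1/4" and z: "?z \<in> cyl a n" "(T ^^ n) ?z = 3/4"
    using inv_branches[OF assms, of "1/4"] inv_branches[OF assms, of "3/4"] by simp_all
  have "1/2 \<le> P * \<bar>?y - ?z\<bar>"
    using cyl_expand_upper[of n a ?y ?z] digitsD[OF assms] y z unfolding P_def by simp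
  then have "inverse (2 * P) \<le> \<bar>?y - ?z\<bar>"
    using \<open>0 < P\<close> by (simp add: field_simps)
  \<comment> \<open>Branches may reverse orientation, so the order of \<open>?y\<close> and
    \<open>?z\<close> is unknown.\<close>
  then have "inverse (2 * P) \<le> ?z - ?y \<or> inverse (2 * P) \<le> ?y - ?z" by linarith
  then show ?thesis using y z unfolding P_def by blast
qed

lemma cyl_disjoint:
  assumes "\<And>j. j < n \<Longrightarrow> 1 \<le> a j" "\<And>j. j < n \<Longrightarrow> 1 \<le> c j" "x \<in> cyl a n" "x \<in> cyl c n" "j < n"
  shows "a j = c j"
  using assms branch_unique[of "a j" "c j" "(T ^^ j) x"] by (auto simp: cyl_def)

text \<open>If the closures of the branches used lie inside \<open>(0,1)\<close>, the intersection of the nested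
  cylinders contains no endpoints.\<close>

lemma coded_exists:
  assumes "digits a" and inside: "\<And>j. closure (J (a j)) \<subseteq> {0<..<1}"
  shows "\<exists>x. coded a x"
proof -
  \<comment> \<open>Pulling back the closure of the next branch gives a compact subset of the
    cylinder, because the inverse branches are continuous on \<open>{0<..<1}\<close>, where
    \<open>inside\<close> places that closure.\<close>
  define K where "K n = inv_branches a n ` closure (J (a n))" for n
  have K_sub: "K n \<subseteq> cyl a n" for n
    using inside[of n] cyl_eq_image[OF assms(1)] unfolding K_def by blast
  have "K (Suc n) \<subseteq> K n" for n
  proof -
    have "inv_branch (a n) ` closure (J (a (Suc n))) \<subseteq> closure (J (a n))"
      using inv_branch(1)[OF digitsD[OF assms(1)]] inside[of "Suc n"] closure_subset by blast
    then show ?thesis unfolding K_def by auto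
  qed
  then have "K n \<subseteq> K m" if "m \<le> n" for m n
    using that by (rule lift_Suc_antimono_le[of K])
  moreover have "compact (K n)" for n
  proof -
    have "bounded (J (a n))" using branch_subset[OF digitsD[OF assms(1)]] bounded_closed_interval bounded_subset by blast
    then have "compact (closure (J (a n)))" by (simp add: compact_closure)
    then show ?thesis
      unfolding K_def using continuous_inv_branches[OF assms(1)] inside
      by (intro compact_continuous_image) (auto intro: continuous_on_subset)
  qed
  moreover have "K n \<noteq> {}" for n
    using branch_image[OF digitsD[OF assms(1)], of n] closure_subset[of "J (a n)"] unfolding K_def by auto
  ultimately have "\<Inter>(range K) \<noteq> {}" by (intro compact_nest) auto
  then obtain x where "\<And>n. x \<in> cyl a n" using K_sub by blast
  then have "(T ^^ j) x \<in> J (a j)" for j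
    using cyl_Suc[of a j] by blast
  then show ?thesis using assms(1) by (auto simp: coded_def)
qed

section \<open>Differentiability of the iterates\<close>

lemma cyl_DERIV:
  assumes "\<And>j. j < n \<Longrightarrow> 1 \<le> a j" "x \<in> cyl a n"
  shows "((T ^^ n) has_real_derivative (\<Prod>j<n. deriv T ((T ^^ j) x))) (at x)"
  using assms
proof (induction n)
  case 0
  then show ?case by (simp add: id_def)
next
  case (Suc n)
  then have "((T ^^ n) has_real_derivative (\<Prod>j<n. deriv T ((T ^^ j) x))) (at x)"
    and "(T has_real_derivative deriv T ((T ^^ n) x)) (at ((T ^^ n) x))"
    using branch_DERIV[of "a n" "(T ^^ n) x"] by (auto simp: cyl_Suc)
  from DERIV_chain[OF this(2,1)] show ?case by (simp add: o_def mult.commute)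
qed

text \<open>Openness puts coded points in the interior of the domain of \<open>T ^^ n\<close>, where
  the relative derivative is two-sided.\<close>

lemma open_cyl:
  assumes "\<And>j. j < n \<Longrightarrow> 1 \<le> a j" shows "open (cyl a n)"
  using assms
proof (induction n)
  case (Suc n)
  have "continuous_on (cyl a n) (T ^^ n)"
    using Suc.prems cyl_DERIV[of n a] by (meson DERIV_isCont continuous_at_imp_continuous_on less_SucI)
  then have "open (cyl a n \<inter> (T ^^ n) -` J (a n))"
    using Suc branch_open by (intro continuous_open_preimage) auto
  moreover have "cyl a (Suc n) = cyl a n \<inter> (T ^^ n) -` J (a n)" by (auto simp: cyl_Suc)
  ultimately show ?case by simp
qed simp

end

section \<open>Lyapunov exponents and the upper bound\<close>

text \<open>Turns estimates of products into inequalities linear in \<open>n\<close> and in the sum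
  of the log digits.\<close>

lemma prod_powr_eq_exp:
  fixes b :: "nat \<Rightarrow> nat" and K e :: real
  assumes "0 < K" "\<And>j. j < n \<Longrightarrow> 1 \<le> b j"
  shows "(\<Prod>j<n. K * real (b j) powr e) = exp (real n * ln K + e * (\<Sum>j<n. ln (real (b j))))"
proof -
  have "(\<Prod>j<n. K * real (b j) powr e) = (\<Prod>j<n. exp (ln K + e * ln (real (b j))))"
  proof (rule prod.cong)
    fix j assume "j \<in> {..<n}"
    then have "1 \<le> b j" using assms(2) by simp
    then show "K * real (b j) powr e = exp (ln K + e * ln (real (b j)))"
      using assms(1) by (simp add: powr_def exp_add)
  qed simp
  also have "\<dots> = exp (\<Sum>j<n. ln K + e * ln (real (b j)))"
    by (simp add: exp_sum)
  finally show ?thesis by (simp add: sum.distrib sum_distrib_left)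
qed

text \<open>Serves to compare the normalized log derivative with \<open>\<gamma>\<close> times the
  mean log digit: divergence to infinity survives a bounded error and a positive factor.\<close>

lemma filterlim_at_top_bounded_diff:
  fixes f g :: "'a \<Rightarrow> real"
  assumes "0 < c" "eventually (\<lambda>x. \<bar>f x - c * g x\<bar> \<le> K) F"
  shows "filterlim f at_top F \<longleftrightarrow> filterlim g at_top F"
proof
  assume f: "filterlim f at_top F"
  show "filterlim g at_top F"
    unfolding filterlim_at_top
  proof
    fix Z
    have "eventually (\<lambda>x. c * Z + K \<le> f x) F" using f by (simp add: filterlim_at_top)
    with assms(2) show "eventually (\<lambda>x. Z \<le> g x) F"
    proof eventually_elim
      case (elim x)
      then have "c * Z \<le> c * g x" by linarith
      then show ?case using \<open>0 < c\<close> by simp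
    qed
  qed
next
  assume g: "filterlim g at_top F"
  show "filterlim f at_top F"
    unfolding filterlim_at_top
  proof
    fix Z
    have "eventually (\<lambda>x. (Z + K) / c \<le> g x) F" using g by (simp add: filterlim_at_top)
    with assms(2) show "eventually (\<lambda>x. Z \<le> f x) F"
    proof eventually_elim
      case (elim x)
      then have "Z + K \<le> c * g x" using \<open>0 < c\<close> by (simp add: field_simps)
      then show ?case using elim by linarith
    qed
  qed
qed

context full_branches
begin

lemma branch_subset_I_star: "1 \<le> b \<Longrightarrow> J b \<subseteq> I_star J"
  using closure_subset unfolding I_star_def by fastforce

lemma cyl_subset_iter_dom:
  assumes "digits a" shows "cyl a n \<subseteq> iter_dom (I_star J) T n"
  using branch_subset_I_star[OF digitsD[OF assms]] by (force simp: cyl_def iter_dom_def)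

lemma iter_deriv_coded_iff:
  assumes "coded a x"
  shows "iter_deriv (I_star J) T n x d \<longleftrightarrow> d = (\<Prod>j<n. deriv T ((T ^^ j) x))"
proof -
  have a: "digits a" using assms by (simp add: coded_def)
  have x: "x \<in> interior (iter_dom (I_star J) T n)"
    using cyl_subset_iter_dom[OF a] open_cyl[of n a] digitsD[OF a] coded_cyl[OF assms]
    by (meson interiorI)
  have "((T ^^ n) has_real_derivative (\<Prod>j<n. deriv T ((T ^^ j) x))) (at x)"
    using cyl_DERIV digitsD[OF a] coded_cyl[OF assms] by blast
  then show ?thesis
    using subsetD[OF interior_subset x] DERIV_unique interior_limit_point[OF x]
    by (auto simp: iter_deriv_on_def at_within_interior[OF x])
qed

text \<open>Each factor deviates from the power \<open>\<gamma>\<close> of its digit by at most a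
  factor \<open>C\<close> either way, so the logarithm is off by at most \<open>ln C\<close> per
  step. Division by \<open>n\<close> leaves a bounded error.\<close>

lemma ln_deriv_bounds:
  assumes "coded a x"
  shows "(\<Prod>j<n. deriv T ((T ^^ j) x)) \<noteq> 0"
    and "\<bar>ln \<bar>\<Prod>j<n. deriv T ((T ^^ j) x)\<bar> - \<gamma> * (\<Sum>j<n. ln (real (a j)))\<bar> \<le> real n * ln C"
proof -
  let ?d = "\<bar>\<Prod>j<n. deriv T ((T ^^ j) x)\<bar>" and ?S = "\<Sum>j<n. ln (real (a j))"
  have "exp (real n * ln (inverse C) + \<gamma> * ?S) \<le> ?d"
    unfolding abs_prod
    using C codedD[OF assms] branch_deriv_lower prod_powr_eq_exp[of "inverse C" n a \<gamma>, symmetric]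
    by (auto intro!: prod_mono)
  moreover have "?d \<le> exp (real n * ln C + \<gamma> * ?S)"
    unfolding abs_prod
    using C codedD[OF assms] branch_deriv_upper prod_powr_eq_exp[of C n a \<gamma>, symmetric]
    by (auto intro!: prod_mono)
  moreover have pos: "0 < ?d" using calculation(1) exp_gt_zero less_le_trans by blast
  ultimately have "real n * ln (inverse C) + \<gamma> * ?S \<le> ln ?d" "ln ?d \<le> real n * ln C + \<gamma> * ?S"
    by (simp_all only: ln_ge_iff) (metis exp_gt_zero ln_exp ln_le_cancel_iff)
  moreover have "ln (inverse C) = - ln C" using C by (simp add: ln_inverse)
  ultimately show "\<bar>ln ?d - \<gamma> * ?S\<bar> \<le> real n * ln C"
    by (simp add: abs_le_iff)
  show "(\<Prod>j<n. deriv T ((T ^^ j) x)) \<noteq> 0" using pos by simp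
qed

definition mean_log :: "(nat \<Rightarrow> nat) \<Rightarrow> nat \<Rightarrow> real" where
  "mean_log a n = (\<Sum>j<n. ln (real (a j))) / real n"

lemma lyapunov_infinity_iff:
  assumes "coded a x"
  shows "has_lyapunov_exponent T J x \<infinity> \<longleftrightarrow> filterlim (mean_log a) at_top sequentially"
proof -
  define d where "d n = (\<Prod>j<n. deriv T ((T ^^ j) x))" for n
  have "has_lyapunov_exponent T J x \<infinity> \<longleftrightarrow>
      (\<lambda>n. if d n = 0 then -\<infinity> else ereal (1 / real n * ln \<bar>d n\<bar>)) \<longlonglongrightarrow> \<infinity>"
  proof -
    \<comment> \<open>A witness for the exponent can differ from \<open>d\<close> at index 0 only,
      which the limit ignores.\<close>
    have "(\<lambda>n. if d' n = 0 then -\<infinity> else ereal (1 / real n * ln \<bar>d' n\<bar>)) \<longlonglongrightarrow> \<infinity> \<longleftrightarrow>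
        (\<lambda>n. if d n = 0 then -\<infinity> else ereal (1 / real n * ln \<bar>d n\<bar>)) \<longlonglongrightarrow> \<infinity>"
      if "\<forall>n\<ge>1. d' n = d n" for d'
      by (rule tendsto_cong, rule eventually_sequentiallyI[of 1]) (use that in simp)
    then show ?thesis
      unfolding has_lyapunov_exponent_def iter_deriv_coded_iff[OF assms] d_def[symmetric] by blast
  qed
  also have "\<dots> \<longleftrightarrow> filterlim (\<lambda>n. 1 / real n * ln \<bar>d n\<bar>) at_top sequentially"
    using ln_deriv_bounds(1)[OF assms] by (simp add: d_def tendsto_PInfty_eq_at_top)
  also have "\<dots> \<longleftrightarrow> filterlim (mean_log a) at_top sequentially"
  proof (rule filterlim_at_top_bounded_diff)
    show "0 < \<gamma>" using gamma by simp
    show "\<forall>\<^sub>F n in sequentially. \<bar>1 / real n * ln \<bar>d n\<bar> - \<gamma> * mean_log a n\<bar> \<le> ln C"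
    proof (rule eventually_sequentiallyI[of 1])
      fix n :: nat assume "1 \<le> n"
      have "1 / real n * ln \<bar>d n\<bar> - \<gamma> * mean_log a n =
          (ln \<bar>d n\<bar> - \<gamma> * (\<Sum>j<n. ln (real (a j)))) / real n"
        by (simp add: mean_log_def diff_divide_distrib)
      then show "\<bar>1 / real n * ln \<bar>d n\<bar> - \<gamma> * mean_log a n\<bar> \<le> ln C"
        using ln_deriv_bounds(2)[OF assms, of n] \<open>1 \<le> n\<close>
        by (simp add: d_def abs_divide divide_le_eq mult.commute)
    qed
  qed
  finally show ?thesis .
qed

text \<open>On words with geometric mean at least \<open>e\<^sup>M\<close>, part of the exponent \<open>s\<close> can be traded for a
  factor \<open>e\<^sup>-\<^sup>M\<^sup>n\<close> (up to constants); what remains is summable as long as \<open>s > 1 / \<gamma>\<close>.\<close>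

lemma hausdorff_measure_fast_growth:
  assumes s: "1 / \<gamma> < s"
  shows "hausdorff_measure s {x. \<exists>a. coded a x \<and> filterlim (mean_log a) at_top sequentially} = 0"
proof -
  have "0 < 1 / \<gamma>" using gamma by simp
  then have "0 < s" using s by linarith
  \<comment> \<open>The midpoint keeps \<open>\<gamma> * t > 1\<close>, for summability over the
    digits, and leaves a gap \<open>s - t\<close> to be traded.\<close>
  define t where "t = (s + 1 / \<gamma>) / 2"
  have t: "1 / \<gamma> < t" "t < s" using s by (auto simp: t_def)
  have summable: "summable (\<lambda>b. real b powr (- (\<gamma> * t)))"
    using t(1) gamma by (subst summable_real_powr_iff) (simp add: field_simps)
  \<comment> \<open>The term at \<open>b = 0\<close> vanishes, since \<open>powr\<close> with base 0
    is 0.\<close>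
  define Z where "Z = (\<Sum>b. real b powr (- (\<gamma> * t)))"
  have "0 \<le> Z" unfolding Z_def using summable by (intro suminf_nonneg) auto
  \<comment> \<open>\<open>M\<close> is chosen so that \<open>\<kappa> = 1 / (2 * (Z + 1))\<close>,
    which makes the sum \<open>\<kappa> * Z\<close> over one digit at most 1/2.\<close>
  define M where "M = ln (2 * C powr s * (Z + 1)) / (\<gamma> * (s - t))"
  define \<kappa> where "\<kappa> = C powr s * exp (- \<gamma> * (s - t) * M)"
  have "0 < \<kappa>" using C by (simp add: \<kappa>_def)
  have ln_\<kappa>: "ln \<kappa> = s * ln C - \<gamma> * (s - t) * M"
    using C by (simp add: \<kappa>_def ln_mult ln_powr)
  have "\<gamma> * (s - t) * M = ln (2 * C powr s * (Z + 1))"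
    using gamma t by (simp add: M_def)
  then have "exp (- \<gamma> * (s - t) * M) = inverse (2 * C powr s * (Z + 1))"
    using C \<open>0 \<le> Z\<close> by (simp add: exp_minus)
  then have "\<kappa> = C powr s * inverse (2 * C powr s * (Z + 1))"
    by (simp add: \<kappa>_def)
  also have "\<dots> = inverse (2 * (Z + 1))"
    using C by (simp only: inverse_mult_distrib) simp
  finally have "\<kappa> = inverse (2 * (Z + 1))" .
  then have \<kappa>Z: "\<kappa> * Z \<le> 1/2"
    using \<open>0 \<le> Z\<close> \<open>0 < \<kappa>\<close> by (simp add: field_simps)
  define g where "g b = ennreal (\<kappa> * real b powr (- (\<gamma> * t)))" for b :: nat
  have sum_g: "(\<Sum>b. g b) = ennreal (\<kappa> * Z)"
    unfolding g_def Z_def using summable \<open>0 < \<kappa>\<close>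
    by (intro suminf_ennreal_eq) (auto intro: sums_mult)
  \<comment> \<open>Divergence of the means gives the bound only from some index on; stratifying by
    that index makes one order \<open>n\<close> serve all points of \<open>E N\<close>.\<close>
  define E where "E N = {x. \<exists>a. coded a x \<and> (\<forall>n\<ge>N. M * real n \<le> (\<Sum>j<n. ln (real (a j))))}" for N
  have "hausdorff_measure s (E N) = 0" for N
  proof (rule hausdorff_measure_eq_0I[OF \<open>0 < s\<close>])
    fix \<epsilon> :: real assume "0 < \<epsilon>"
    then obtain m where m: "(1/2) ^ m < \<epsilon>" using real_arch_pow_inv[of \<epsilon> "1/2"] by auto
    define n where "n = max N m"
    have "(1/2::real) ^ n \<le> (1/2) ^ m" by (intro power_decreasing) (auto simp: n_def)
    then have n: "N \<le> n" "(1/2) ^ n \<le> \<epsilon>" using m by (simp add: n_def, linarith)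
    define good where "good w \<longleftrightarrow> length w = n \<and> (\<forall>j<n. 1 \<le> w ! j) \<and>
      M * real n \<le> (\<Sum>j<n. ln (real (w ! j)))" for w :: "nat list"
    define U where "U k = (if good (list_decode k) then cyl ((!) (list_decode k)) n else {})" for k
    have "E N \<subseteq> (\<Union>k. U k)"
    proof
      fix x assume "x \<in> E N"
      then obtain a where a: "coded a x" "\<And>n. N \<le> n \<Longrightarrow> M * real n \<le> (\<Sum>j<n. ln (real (a j)))"
        by (auto simp: E_def)
      let ?w = "map a [0..<n]"
      have "good ?w"
        using codedD(1)[OF a(1)] a(2)[OF n(1)] by (simp add: good_def)
      moreover have "x \<in> cyl ((!) ?w) n"
        using coded_cyl[OF a(1), of n] by (simp add: cyl_def)
      ultimately have "x \<in> U (list_encode ?w)" by (simp add: U_def)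
      then show "x \<in> (\<Union>k. U k)" by (rule UN_I[OF UNIV_I])
    qed
    moreover have "bounded (U k)" for k
    proof -
      have "U k \<subseteq> {0..1}" by (auto simp: U_def cyl_def)
      then show ?thesis using bounded_closed_interval bounded_subset by blast
    qed
    moreover have "(\<Sum>k. diam_weight s (U k)) \<le> ennreal \<epsilon>"
    proof -
      have "diam_weight s (U k) \<le> (let w = list_decode k in if length w = n then \<Prod>b\<leftarrow>w. g b else 0)" for k
      proof (cases "good (list_decode k)")
        case True
        define w where "w = list_decode k"
        have w: "length w = n" "\<And>j. j < n \<Longrightarrow> 1 \<le> w ! j" "M * real n \<le> (\<Sum>j<n. ln (real (w ! j)))"
          using True by (auto simp: good_def w_def)
        let ?S = "\<Sum>j<n. ln (real (w ! j))"
        have "diam_weight s (U k) \<le> ennreal (diameter (cyl ((!) w) n) powr s)"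
          using True \<open>0 < s\<close> by (simp add: U_def diam_weight_def w_def)
        also have "\<dots> \<le> ennreal ((\<Prod>j<n. C * real (w ! j) powr (- \<gamma>)) powr s)"
        proof (intro ennreal_leI powr_mono2)
          have "cyl ((!) w) n \<subseteq> {0..1}" by (auto simp: cyl_def)
          then show "0 \<le> diameter (cyl ((!) w) n)"
            using bounded_closed_interval bounded_subset diameter_ge_0 by blast
        qed (use \<open>0 < s\<close> w(2) in \<open>auto intro: cyl_diameter\<close>)
        also have "(\<Prod>j<n. C * real (w ! j) powr (- \<gamma>)) powr s = exp (s * (real n * ln C - \<gamma> * ?S))"
          using C w(2) by (subst prod_powr_eq_exp) (auto simp: powr_def)
        also have "ennreal \<dots> \<le> ennreal (exp (real n * ln \<kappa> + (- (\<gamma> * t)) * ?S))"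
        proof -
          \<comment> \<open>Since \<open>?S\<close> is at least \<open>M * n\<close>, the surplus
            \<open>\<gamma> * (s - t) * ?S\<close> pays for the term with \<open>M\<close> in
            \<open>n * ln \<kappa>\<close>.\<close>
          have "0 \<le> \<gamma> * (s - t) * (?S - M * real n)"
            using gamma t w(3) by simp
          then show ?thesis
            unfolding ln_\<kappa> by (intro ennreal_leI) (simp add: algebra_simps)
        qed
        also have "exp (real n * ln \<kappa> + (- (\<gamma> * t)) * ?S) = (\<Prod>j<n. \<kappa> * real (w ! j) powr (- (\<gamma> * t)))"
          using \<open>0 < \<kappa>\<close> w(2) by (intro prod_powr_eq_exp[symmetric]) auto
        also have "ennreal \<dots> = (\<Prod>j<n. g (w ! j))"
          unfolding g_def using \<open>0 < \<kappa>\<close> by (intro prod_ennreal[symmetric]) auto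
        also have "\<dots> = (\<Prod>b\<leftarrow>w. g b)"
          using w(1) by (simp add: prod.list_conv_set_nth atLeast0LessThan)
        finally show ?thesis using w(1) by (simp add: w_def)
      qed (simp add: U_def diam_weight_def)
      then have "(\<Sum>k. diam_weight s (U k)) \<le> (\<Sum>b. g b) ^ n"
        unfolding suminf_list_prod[symmetric] by (intro suminf_le) auto
      also have "\<dots> \<le> ennreal ((1/2) ^ n)"
        unfolding sum_g using \<kappa>Z \<open>0 < \<kappa>\<close> \<open>0 \<le> Z\<close>
        by (auto simp: ennreal_power intro!: ennreal_leI power_mono)
      also have "\<dots> \<le> ennreal \<epsilon>" using n(2) by (rule ennreal_leI)
      finally show ?thesis .
    qed
    ultimately show "\<exists>U. E N \<subseteq> (\<Union>k. U k) \<and> (\<forall>k. bounded (U k)) \<and> (\<Sum>k. diam_weight s (U k)) \<le> ennreal \<epsilon>"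
      by (intro exI[of _ U]) auto
  qed
  then have null: "hausdorff_measure s (\<Union>N. E N) = 0"
    using \<open>0 < s\<close> by (rule hausdorff_measure_UN_eq_0[rotated])
  have "{x. \<exists>a. coded a x \<and> filterlim (mean_log a) at_top sequentially} \<subseteq> (\<Union>N. E N)"
  proof
    fix x assume "x \<in> {x. \<exists>a. coded a x \<and> filterlim (mean_log a) at_top sequentially}"
    then obtain a where a: "coded a x" "filterlim (mean_log a) at_top sequentially" by blast
    then have "eventually (\<lambda>n. M \<le> mean_log a n) sequentially" by (simp add: filterlim_at_top)
    then obtain N where N: "\<And>n. N \<le> n \<Longrightarrow> M \<le> mean_log a n" by (auto simp: eventually_sequentially)
    have "M * real n \<le> (\<Sum>j<n. ln (real (a j)))" if "N \<le> n" for n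
      using N[OF that] by (cases "n = 0") (auto simp: mean_log_def field_simps)
    then have "x \<in> E N" using a(1) by (auto simp: E_def)
    then show "x \<in> (\<Union>N. E N)" by blast
  qed
  from hausdorff_measure_mono[OF this, of s] null show ?thesis by simp
qed

end

section \<open>The lower bound\<close>

text \<open>The single term \<open>R ^ n / fact n\<close> of the exponential series is at most
  \<open>exp R\<close>. As \<open>R\<close> is free, \<open>ln (fact n)\<close> outgrows every
  linear function of \<open>n\<close>.\<close>

lemma ln_fact_ge:
  fixes R :: real
  assumes "0 < R" shows "real n * ln R - R \<le> ln (fact n)"
proof -
  have "R ^ n /\<^sub>R fact n \<le> exp R"
    unfolding exp_def using sum_le_suminf[OF summable_exp_generic[of R], of "{n}"] assms by simp
  then have "R ^ n \<le> exp R * fact n" by (simp add: field_simps)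
  then have "ln (R ^ n) \<le> ln (exp R * fact n)" using assms by (subst ln_le_cancel_iff) auto
  then show ?thesis using assms by (simp add: ln_realpow ln_mult)
qed

lemma prod_Suc_eq_fact: "(\<Prod>j<n. real (Suc j)) = fact n"
  by (induction n) (auto simp: algebra_simps)

lemma subset_interval_diameter:
  fixes U :: "real set"
  assumes "bounded U" shows "\<exists>p. U \<subseteq> {p..p + diameter U}"
proof (cases "U = {}")
  case False
  have "x \<le> Inf U + diameter U" if "x \<in> U" for x
  proof -
    have "x - diameter U \<le> y" if "y \<in> U" for y
      using diameter_bounded_bound[OF assms \<open>x \<in> U\<close> that] by (simp add: dist_real_def)
    then have "x - diameter U \<le> Inf U" using False by (intro cInf_greatest)
    then show ?thesis by simp
  qed
  then show ?thesis
    using assms by (intro exI[of _ "Inf U"]) (auto intro!: cInf_lower bounded_imp_bdd_below)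
qed simp

context full_branches
begin

section \<open>Branch closures and the counting of cylinders\<close>

text \<open>Let \<open>y\<close> in one branch be at most as far from \<open>p\<close> as
  \<open>z\<close> in the other. The other branch comes closer to \<open>p\<close> than
  \<open>y\<close>, and all points lie on one side of \<open>p\<close>, so \<open>y\<close> is
  between two of its points; disjointness finishes.\<close>

lemma branch_closure_endpoint_unique:
  assumes "1 \<le> b" "1 \<le> c" "p \<in> {0, 1}" "p \<in> closure (J b)" "p \<in> closure (J c)"
  shows "b = c"
proof -
  have *: "b = c" if bc: "1 \<le> b" "1 \<le> c" "p \<in> closure (J c)" and
    y: "y \<in> J b" and z: "z \<in> J c" and le: "\<bar>y - p\<bar> \<le> \<bar>z - p\<bar>" for b c y z
  proof -
    have y01: "y \<in> {0<..<1}" and z01: "z \<in> {0<..<1}"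
      using y z branch_subset_open bc by blast+
    then have "0 < \<bar>y - p\<bar>" using assms(3) by auto
    then obtain z' where z': "z' \<in> J c" "\<bar>z' - p\<bar> < \<bar>y - p\<bar>"
      using bc(3) by (metis closure_approachable dist_real_def)
    have "z' \<in> {0<..<1}" using z' branch_subset_open bc by blast
    then have "z' \<le> y \<and> y \<le> z \<or> z \<le> y \<and> y \<le> z'"
      using y01 z01 z'(2) le assms(3) by auto
    then have "y \<in> J c"
      using branch_interval[OF bc(2)] z z'(1) unfolding is_interval_1 by blast
    then show ?thesis using branch_unique bc y by blast
  qed
  obtain y z where "y \<in> J b" "z \<in> J c" using assms closure_empty by fastforce
  then show ?thesis
    using *[of b c y z] *[of c b z y] assms by linarith
qed

text \<open>Each of 0 and 1 lies in at most one branch closure, so large indices avoid both. This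
  supplies the hypothesis \<open>inside\<close> of \<open>coded_exists\<close>.\<close>

lemma branch_closure_inside:
  "\<exists>M\<ge>1. \<forall>b\<ge>M. closure (J b) \<subseteq> {0<..<1}"
proof -
  have "\<exists>N\<ge>1. \<forall>b\<ge>N. p \<notin> closure (J b)" if "p \<in> {0, 1}" for p
  proof (cases "\<exists>c\<ge>1. p \<in> closure (J c)")
    case True
    then obtain c where c: "1 \<le> c" "p \<in> closure (J c)" by blast
    have "p \<notin> closure (J b)" if "Suc c \<le> b" for b
      using branch_closure_endpoint_unique[of b c p] c \<open>p \<in> {0, 1}\<close> that by auto
    then show ?thesis by (intro exI[of _ "Suc c"]) auto
  qed auto
  from this[of 0] this[of 1] obtain M N where M: "1 \<le> M" "\<And>b. M \<le> b \<Longrightarrow> 0 \<notin> closure (J b)"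
    and N: "1 \<le> N" "\<And>b. N \<le> b \<Longrightarrow> 1 \<notin> closure (J b)" by auto
  have "closure (J b) \<subseteq> {0<..<1}" if "max M N \<le> b" for b
  proof
    fix x assume x: "x \<in> closure (J b)"
    moreover have "closure (J b) \<subseteq> {0..1}"
      using branch_subset[of b] M(1) that by (intro closure_minimal) auto
    ultimately have "x \<in> {0..1}" "x \<noteq> 0" "x \<noteq> 1"
      using M(2)[of b] N(2)[of b] that by auto
    then show "x \<in> {0<..<1}" by auto
  qed
  then show ?thesis using M(1) by (intro exI[of _ "max M N"]) auto
qed

lemma cyl_cong: "(\<And>j. j < n \<Longrightarrow> a j = c j) \<Longrightarrow> cyl a n = cyl c n"
  by (simp add: cyl_def)

text \<open>Digits of size at most \<open>q * (j + 1)\<close> bound the expansion of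
  \<open>T ^^ n\<close> by \<open>(C * q powr \<gamma>) ^ n * fact n powr \<gamma>\<close>. So each
  cylinder contains two points at least \<open>l\<close> apart, and \<open>card_intervals_le\<close>
  applies.\<close>

lemma card_cylinders_le:
  fixes l p q r :: real
  assumes W: "W \<subseteq> (\<Pi>\<^sub>E j\<in>{..<n}. A j)" "finite W"
    and A: "\<And>j b. b \<in> A j \<Longrightarrow> 1 \<le> b \<and> real b \<le> q * real (Suc j)"
    and meets: "\<And>w. w \<in> W \<Longrightarrow> cyl w n \<inter> U \<noteq> {}" and U: "U \<subseteq> {p..p + r}" "0 \<le> r"
    and l: "l = inverse (2 * (C * q powr \<gamma>) ^ n * fact n powr \<gamma>)"
    and q: "0 < q"
  shows "card W * l \<le> r + 2 * l"
proof -
  have pos: "1 \<le> w j" "real (w j) \<le> q * real (Suc j)" if "w \<in> W" "j < n" for w j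
    using A[of "w j" j] W(1) that by (auto simp: PiE_def Pi_def)
  \<comment> \<open>Words are \<open>undefined\<close> from \<open>n\<close> on; padding with the
    digit 1 makes them admissible codes with the same cylinder.\<close>
  have ext: "\<exists>a. digits a \<and> cyl a n = cyl w n \<and> (\<forall>j<n. a j = w j)" if "w \<in> W" for w
    using pos(1)[OF that] cyl_cong[of n w "\<lambda>j. if j < n then w j else 1"]
    by (intro exI[of _ "\<lambda>j. if j < n then w j else 1"]) (auto simp: digits_def)
  have "card W * l \<le> (p + r) - p + 2 * l"
  proof (rule card_intervals_le[OF W(2), of "\<lambda>w. cyl w n"])
    show "disjoint_family_on (\<lambda>w. cyl w n) W"
      unfolding disjoint_family_on_def
    proof (intro ballI impI)
      fix w w' assume w: "w \<in> W" "w' \<in> W" "w \<noteq> w'"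
      have "w = w'" if "x \<in> cyl w n" "x \<in> cyl w' n" for x
      proof (rule PiE_ext)
        show "w \<in> (\<Pi>\<^sub>E j\<in>{..<n}. A j)" "w' \<in> (\<Pi>\<^sub>E j\<in>{..<n}. A j)" using w W(1) by auto
        show "w j = w' j" if "j \<in> {..<n}" for j
          using cyl_disjoint[of n w w' x j] pos(1) w that \<open>x \<in> cyl w n\<close> \<open>x \<in> cyl w' n\<close> by auto
      qed
      then show "cyl w n \<inter> cyl w' n = {}" using w by blast
    qed
    show "0 < l" unfolding l using C q by simp
    fix w assume w: "w \<in> W"
    then obtain a where a: "digits a" "cyl a n = cyl w n" "\<And>j. j < n \<Longrightarrow> a j = w j"
      using ext by blast
    show "is_interval (cyl w n)" using is_interval_cyl[OF a(1)] a(2) by metis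
    show "cyl w n \<inter> {p..p + r} \<noteq> {}" using meets[OF w] U by blast
    have "(\<Prod>j<n. C * real (a j) powr \<gamma>) \<le> (\<Prod>j<n. (C * q powr \<gamma>) * real (Suc j) powr \<gamma>)"
    proof (intro prod_mono conjI)
      fix j assume "j \<in> {..<n}"
      then have "real (a j) powr \<gamma> \<le> (q * real (Suc j)) powr \<gamma>"
        using pos(2)[OF w, of j] a(3)[of j] gamma by (intro powr_mono2) auto
      also have "\<dots> = q powr \<gamma> * real (Suc j) powr \<gamma>" using q by (intro powr_mult)
      finally have "C * real (a j) powr \<gamma> \<le> C * (q powr \<gamma> * real (Suc j) powr \<gamma>)"
        using C by (intro mult_left_mono) auto
      then show "C * real (a j) powr \<gamma> \<le> (C * q powr \<gamma>) * real (Suc j) powr \<gamma>" by (simp add: mult.assoc)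
    qed (use C in auto)
    also have "\<dots> = (C * q powr \<gamma>) ^ n * fact n powr \<gamma>"
    proof -
      have "(\<Prod>j<n. real (Suc j) powr \<gamma>) = (\<Prod>j<n. real (Suc j)) powr \<gamma>"
        by (rule prod_powr_distrib[symmetric])
      then show ?thesis by (simp add: prod.distrib prod_Suc_eq_fact del: of_nat_Suc)
    qed
    finally have "l \<le> inverse (2 * (\<Prod>j<n. C * real (a j) powr \<gamma>))"
      unfolding l using C digitsD[OF a(1)]
      by (intro le_imp_inverse_le mult_pos_pos prod_pos) (auto simp: mult.assoc Suc_le_eq)
    then show "\<exists>y\<in>cyl w n. \<exists>z\<in>cyl w n. l \<le> z - y"
      using cyl_long[OF a(1), of n] a(2) by (metis order_trans)
  qed (use U in auto)
  then show ?thesis by simp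
qed


text \<open>A cover element of diameter \<open>r\<close> with \<open>l (n + 1) \<le> r < l n\<close> is measured with cylinders of
  order \<open>n\<close> and of order \<open>n + 1\<close>; the two resulting bounds are interpolated geometrically.\<close>

lemma interpolated_bound:
  fixes D s :: real
  assumes D: "1 \<le> D" and s: "0 < s" "s < 1" "\<gamma> * s < 1"
  defines "l \<equiv> \<lambda>n. inverse (2 * D ^ n * fact n powr \<gamma>)"
  shows "\<exists>K>0. \<forall>r>0. \<exists>n. min 1 ((r / l n + 2) / fact n) \<le> K * r powr s"
proof -
  \<comment> \<open>This is the coefficient of \<open>- ln (fact n)\<close> left after
    interpolation, namely \<open>(1 - s) - (\<gamma> - 1) * s\<close>.\<close>
  define \<theta> where "\<theta> = 1 - \<gamma> * s"
  have "0 < \<theta>" using s by (simp add: \<theta>_def)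
  \<comment> \<open>\<open>\<theta> * ln R\<close> equals the linear growth rate of the remaining
    terms, so everything proportional to \<open>n\<close> cancels and \<open>k\<close> is
    left.\<close>
  define R where "R = exp ((s * ln D + (\<gamma> - 1) * s) / \<theta>)"
  have "0 < R" "ln R = (s * ln D + (\<gamma> - 1) * s) / \<theta>" by (simp_all add: R_def)
  define k where "k = \<theta> * R + s * ln D + ln 6"
  have l_pos: "0 < l n" for n using D by (simp add: l_def)
  have k_bound: "s * (real (Suc n) * ln D) + (\<gamma> - 1) * s * ln (real (Suc n)) - \<theta> * ln (fact n) + ln 6 \<le> k" for n
  proof -
    have "\<theta> * (real n * ln R - R) \<le> \<theta> * ln (fact n)"
      using ln_fact_ge[OF \<open>0 < R\<close>, of n] \<open>0 < \<theta>\<close> by (intro mult_left_mono) auto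
    moreover have "\<theta> * (real n * ln R) = real n * (s * ln D + (\<gamma> - 1) * s)"
      using \<open>0 < \<theta>\<close> by (simp add: \<open>ln R = _\<close>)
    moreover have "(\<gamma> - 1) * s * ln (real (Suc n)) \<le> (\<gamma> - 1) * s * real n"
      using gamma s(1) ln_add_one_self_le_self[of "real n"] by (intro mult_left_mono) (auto simp: add.commute)
    ultimately show ?thesis by (simp add: k_def algebra_simps)
  qed
  define K where "K = max 2 (exp k)"
  have "0 < K" by (simp add: K_def)
  have "\<exists>n. min 1 ((r / l n + 2) / fact n) \<le> K * r powr s" if "0 < r" for r
  proof (cases "1/2 \<le> r")
    case True
    \<comment> \<open>For large \<open>r\<close> the trivial bound 1 suffices, since
      \<open>K\<close> is at least 2 and \<open>r powr s\<close> at least 1/2.\<close>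
    have "1/2 \<le> (1/2 :: real) powr s"
      using powr_mono'[of s 1 "1/2"] s by simp
    also have "\<dots> \<le> r powr s" using True s by (intro powr_mono2) auto
    finally have "2 * (1/2) \<le> K * r powr s" by (intro mult_mono) (auto simp: K_def)
    then show ?thesis by (intro exI[of _ 0]) simp
  next
    case False
    have "\<exists>n. l n \<le> r"
    proof -
      obtain m :: nat where m: "inverse r < real m" using reals_Archimedean2 by blast
      have "real m \<le> fact m" using fact_ge_self[of m] of_nat_mono by fastforce
      also have "(fact m :: real) = 1 * fact m powr 1" by simp
      also have "\<dots> \<le> (2 * D ^ m) * fact m powr \<gamma>"
        using gamma one_le_power[OF D, of m]
        by (intro mult_mono powr_mono) (auto intro: fact_ge_1)
      finally have "inverse r < 2 * D ^ m * fact m powr \<gamma>" using m by linarith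
      then have "inverse (2 * D ^ m * fact m powr \<gamma>) < inverse (inverse r)"
        using \<open>0 < r\<close> by (intro less_imp_inverse_less) auto
      then show ?thesis unfolding l_def by (intro exI[of _ m]) simp
    qed
    define N where "N = (LEAST n. l n \<le> r)"
    have N: "l N \<le> r" unfolding N_def using \<open>\<exists>n. l n \<le> r\<close> by (rule LeastI_ex)
    \<comment> \<open>\<open>l 0\<close> is 1/2, so \<open>N\<close> is not 0 when
      \<open>r < 1/2\<close>; minimality then gives \<open>r < l n\<close> at the
      predecessor.\<close>
    obtain n where n: "N = Suc n" using N False by (cases N) (auto simp: l_def)
    have "r < l n" using not_less_Least[of n "\<lambda>n. l n \<le> r"] n by (simp add: N_def)
    define L where "L = ln (fact n :: real)"
    define A where "A = ln (real (Suc n))"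
    \<comment> \<open>\<open>X\<close> bounds the estimate of order \<open>n\<close>, where
      \<open>r / l n\<close> is below 1, and \<open>Y\<close> that of order \<open>N\<close>, where
      \<open>r / l N\<close> is at least 1.\<close>
    define X where "X = 3 / (fact n :: real)"
    define Y where "Y = 3 * r * (2 * D ^ Suc n * fact (Suc n) powr \<gamma>) / fact (Suc n)"
    have "0 < X" "0 < Y" using \<open>0 < r\<close> D by (simp_all add: X_def Y_def)
    have ln_X: "ln X = ln 3 - L" by (simp add: X_def L_def ln_div)
    have ln_fact_Suc: "ln (fact (Suc n) :: real) = A + L"
      unfolding A_def L_def fact_Suc of_nat_mult by (intro ln_mult_pos) auto
    have ln_6: "ln (6 :: real) = ln 3 + ln 2" by (simp flip: ln_mult_pos)
    have "ln (3 * r * (2 * a * b) / c) = ln 3 + ln r + ln 2 + ln a + ln b - ln c"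
      if "0 < a" "0 < b" "0 < c" for a b c
      using that \<open>0 < r\<close> by (simp only: ln_divide_pos ln_mult_pos mult_pos_pos zero_less_numeral)
    from this[of "D ^ Suc n" "fact (Suc n) powr \<gamma>" "fact (Suc n)"]
    have "ln Y = ln 3 + ln r + ln 2 + real (Suc n) * ln D + \<gamma> * (A + L) - (A + L)"
      using D unfolding Y_def ln_realpow ln_powr ln_fact_Suc by (simp add: ln_realpow)
    then have ln_Y: "ln Y = ln 3 + ln r + ln 2 + real (Suc n) * ln D + (\<gamma> - 1) * (A + L)"
      by (simp add: algebra_simps)
    \<comment> \<open>Combine \<open>ln X\<close> and \<open>ln Y\<close> with weights
      \<open>1 - s\<close> and \<open>s\<close>: only \<open>Y\<close> depends on \<open>r\<close>,
      and linearly, so exactly \<open>s * ln r\<close> appears. If both bounds failed, the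
      combination would exceed \<open>k + s * ln r\<close>, against \<open>k_bound\<close>.\<close>
    have "X \<le> K * r powr s \<or> Y \<le> K * r powr s"
    proof (rule ccontr)
      assume "\<not> ?thesis"
      then have "K * r powr s < X" "K * r powr s < Y" by auto
      moreover have "0 < K * r powr s" using \<open>0 < K\<close> \<open>0 < r\<close> by simp
      moreover have "k + s * ln r \<le> ln (K * r powr s)"
      proof -
        have "k \<le> ln K" using \<open>0 < K\<close> by (subst ln_ge_iff) (auto simp: K_def)
        then show ?thesis using \<open>0 < K\<close> \<open>0 < r\<close> by (simp add: ln_mult_pos ln_powr)
      qed
      ultimately have lt: "k + s * ln r < ln X" "k + s * ln r < ln Y"
        using \<open>0 < X\<close> \<open>0 < Y\<close> ln_less_cancel_iff by (smt (verit))+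
      have "(1 - s) * (k + s * ln r) + s * (k + s * ln r) < (1 - s) * ln X + s * ln Y"
        using lt s by (intro add_strict_mono mult_strict_left_mono) auto
      also have "\<dots> = s * (real (Suc n) * ln D) + (\<gamma> - 1) * s * A - \<theta> * L + ln 3 + s * ln 2 + s * ln r"
        unfolding ln_X ln_Y \<theta>_def by (simp add: algebra_simps)
      also have "\<dots> \<le> k + s * ln r"
      proof -
        have "s * ln 2 \<le> 1 * ln (2 :: real)" using s by (intro mult_right_mono) auto
        then show ?thesis using k_bound[of n] ln_6 unfolding A_def L_def by linarith
      qed
      finally show False by (simp add: algebra_simps)
    qed
    moreover have "(r / l n + 2) / fact n \<le> X"
    proof -
      have "r / l n \<le> 1" using \<open>r < l n\<close> l_pos[of n] by simp
      then show ?thesis unfolding X_def by (intro divide_right_mono) auto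
    qed
    moreover have "(r / l N + 2) / fact N \<le> Y"
    proof -
      have "1 \<le> r / l N" using N l_pos[of N] by simp
      then have "(r / l N + 2) / fact N \<le> (3 * (r / l N)) / fact N" by (intro divide_right_mono) auto
      also have "\<dots> = Y" unfolding Y_def l_def n divide_inverse inverse_inverse_eq by (simp only: mult.assoc)
      finally show ?thesis .
    qed
    ultimately show ?thesis by (meson min.coboundedI2 order_trans)
  qed
  then show ?thesis using \<open>0 < K\<close> by blast
qed


section \<open>Mass distribution on the space of codes\<close>

text \<open>The mass lives on code sequences, and \<open>E\<close> only has to contain a point for
  each of them. A cover of \<open>E\<close> with sum below \<open>1 / (4 * K)\<close> would bound
  the total mass 1 by 3/4.\<close>

lemma hausdorff_measure_coded_pos:
  assumes s: "0 < s" "s < 1 / \<gamma>" and "1 \<le> M"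
    and E: "\<And>a. (\<And>j. a j \<in> {M + j..<M + 2 * j + 1}) \<Longrightarrow> \<exists>x\<in>E. coded a x"
  shows "hausdorff_measure s E \<noteq> 0"
proof
  assume null: "hausdorff_measure s E = 0"
  define A where "A j = {M + j..<M + 2 * j + 1}" for j
  have A: "finite (A j)" "A j \<noteq> {}" "card (A j) = Suc j" for j by (auto simp: A_def)
  define P where "P = Pi\<^sub>M UNIV (\<lambda>j. uniform_count_measure (A j))"
  interpret P: product_prob_space "\<lambda>j. uniform_count_measure (A j)" UNIV
    by (intro product_prob_spaceI prob_space_uniform_count_measure A)
  have space_P: "space P = (\<Pi>\<^sub>E j\<in>UNIV. A j)"
    by (simp add: P_def space_PiM space_uniform_count_measure)
  define code where "code a = (SOME x. x \<in> E \<and> coded a x)" for a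
  have code: "code a \<in> E" "coded a (code a)" if "a \<in> space P" for a
  proof -
    have "\<exists>x. x \<in> E \<and> coded a x" using E[of a] that by (auto simp: space_P A_def PiE_def Pi_def)
    from someI_ex[OF this] show "code a \<in> E" "coded a (code a)" by (auto simp: code_def)
  qed
  \<comment> \<open>The largest element \<open>M + 2 * j\<close> of \<open>A j\<close> is at most
    \<open>(M + 2) * (j + 1)\<close>.\<close>
  define q where "q = real (M + 2)"
  have digit: "1 \<le> b \<and> real b \<le> q * real (Suc j)" if "b \<in> A j" for b j
  proof -
    have "b \<le> (M + 2) * Suc j" using that by (auto simp: A_def algebra_simps)
    then have "real b \<le> q * real (Suc j)" unfolding q_def of_nat_mult[symmetric] by (rule of_nat_mono)
    then show ?thesis using that \<open>1 \<le> M\<close> by (simp add: A_def)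
  qed
  define D where "D = C * q powr \<gamma>"
  define l where "l n = inverse (2 * D ^ n * fact n powr \<gamma>)" for n
  have "1 * 1 \<le> D"
    unfolding D_def using C gamma by (intro mult_mono ge_one_powr_ge_zero) (auto simp: q_def)
  then have D: "1 \<le> D" by simp
  have l_pos: "0 < l n" for n using D by (simp add: l_def)
  have gs: "\<gamma> * s < 1" using s gamma by (simp add: field_simps)
  have "1 * s \<le> \<gamma> * s" using gamma s by (intro mult_right_mono) auto
  then have "s < 1" using gs by simp
  from interpolated_bound[OF D s(1) this gs] obtain K where K: "0 < K"
    "\<And>r. 0 < r \<Longrightarrow> \<exists>n. min 1 ((r / l n + 2) / fact n) \<le> K * r powr s"
    unfolding l_def by blast

  \<comment> \<open>\<open>code\<close> comes from a choice, so its preimages may fail to be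
    measurable; hence the measurable superset \<open>V\<close>, a finite union of cylinders in the
    code space.\<close>
  have mass: "\<exists>V\<in>sets P. {a \<in> space P. code a \<in> U} \<subseteq> V \<and> emeasure P V \<le> ennreal (K * r powr s)"
    if U: "U \<subseteq> {p..p + r}" and r: "0 < r" for U :: "real set" and p r :: real
  proof -
    from K(2)[OF r] obtain n where n: "min 1 ((r / l n + 2) / fact n) \<le> K * r powr s" by blast
    define W where "W = {w \<in> (\<Pi>\<^sub>E j\<in>{..<n}. A j). cyl w n \<inter> U \<noteq> {}}"
    have "finite W" unfolding W_def using A(1) by (intro finite_Collect_conjI disjI1) (simp add: finite_PiE)
    define cy where "cy w = {a \<in> space P. \<forall>j\<in>{..<n}. a j \<in> {w j}}" for w :: "nat \<Rightarrow> nat"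
    have cy: "cy w \<in> sets P" "emeasure P (cy w) = ennreal (1 / fact n)" if "w \<in> W" for w
    proof -
      have w: "{w j} \<in> sets (uniform_count_measure (A j))" if "j < n" for j
        using \<open>w \<in> W\<close> that by (auto simp: W_def sets_uniform_count_measure PiE_def Pi_def)
      have "{a \<in> space P. a j \<in> {w j}} \<in> sets P" if "j < n" for j
        using measurable_sets[OF measurable_component_singleton[of j UNIV "\<lambda>j. uniform_count_measure (A j)"] w[OF that]]
        by (simp add: P_def vimage_def Int_def conj_commute)
      then show "cy w \<in> sets P"
        unfolding cy_def by (intro sets.sets_Collect_finite_All) auto
      have "emeasure P (cy w) = (\<Prod>j<n. emeasure (uniform_count_measure (A j)) {w j})"
        unfolding cy_def P_def using w by (intro P.emeasure_PiM_Collect) auto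
      also have "\<dots> = (\<Prod>j<n. ennreal (1 / real (Suc j)))"
        using \<open>w \<in> W\<close> A
        by (intro prod.cong) (auto simp: emeasure_uniform_count_measure W_def PiE_def Pi_def)
      also have "\<dots> = ennreal (\<Prod>j<n. 1 / real (Suc j))" by (intro prod_ennreal) auto
      also have "(\<Prod>j<n. 1 / real (Suc j)) = 1 / fact n"
        by (simp add: prod_dividef prod_Suc_eq_fact del: of_nat_Suc)
      finally show "emeasure P (cy w) = ennreal (1 / fact n)" .
    qed
    define V where "V = (\<Union>w\<in>W. cy w)"
    have "V \<in> sets P" unfolding V_def using cy(1) \<open>finite W\<close> by (intro sets.finite_UN) auto
    moreover have "{a \<in> space P. code a \<in> U} \<subseteq> V"
    proof
      fix a assume "a \<in> {a \<in> space P. code a \<in> U}"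
      then have a: "a \<in> space P" "code a \<in> U" by auto
      let ?w = "restrict a {..<n}"
      have "code a \<in> cyl ?w n"
        using coded_cyl[OF code(2)[OF a(1)], of n] by (simp add: cyl_def)
      then have "?w \<in> W" using a by (auto simp: W_def space_P)
      moreover have "a \<in> cy ?w" using a(1) by (simp add: cy_def)
      ultimately show "a \<in> V" unfolding V_def by blast
    qed
    moreover have "emeasure P V \<le> ennreal (K * r powr s)"
    proof -
      have "real (card W) * l n \<le> r + 2 * l n"
        using \<open>finite W\<close> U r digit
        by (intro card_cylinders_le[where A = A and q = q and U = U and p = p])
          (auto simp: W_def l_def D_def q_def)
      then have card: "real (card W) \<le> r / l n + 2"
        using l_pos[of n] by (simp add: field_simps)
      have "emeasure P V \<le> (\<Sum>w\<in>W. emeasure P (cy w))"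
        unfolding V_def using cy(1) \<open>finite W\<close> by (intro emeasure_subadditive_finite) auto
      also have "\<dots> = ennreal (real (card W) / fact n)"
        by (simp add: cy(2) ennreal_of_nat_eq_real_of_nat ennreal_mult[symmetric])
      also have "\<dots> \<le> ennreal ((r / l n + 2) / fact n)"
        using card by (intro ennreal_leI divide_right_mono) auto
      finally have "emeasure P V \<le> ennreal ((r / l n + 2) / fact n)" .
      moreover have "emeasure P V \<le> ennreal 1"
        using P.emeasure_le_1[of V] by (simp add: P_def)
      ultimately have "emeasure P V \<le> ennreal (min 1 ((r / l n + 2) / fact n))"
        by (simp add: min_def)
      also have "\<dots> \<le> ennreal (K * r powr s)" using n by (rule ennreal_leI)
      finally show ?thesis .
    qed
    ultimately show ?thesis by blast
  qed

  obtain U where U: "E \<subseteq> (\<Union>i. U i)" "\<And>i. bounded (U i)"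
    "(\<Sum>i. diam_weight s (U i)) < ennreal (1 / (4 * K))"
    using hausdorff_measure_eq_0D[OF null, of "1 / (4 * K)" 1] K(1) by auto
  have "\<forall>i. \<exists>V. V \<in> sets P \<and> {a \<in> space P. code a \<in> U i} \<subseteq> V \<and>
      emeasure P V \<le> ennreal K * diam_weight s (U i) + ennreal (1/2 * (1/2) ^ Suc i)"
  proof
    fix i
    show "\<exists>V. V \<in> sets P \<and> {a \<in> space P. code a \<in> U i} \<subseteq> V \<and>
        emeasure P V \<le> ennreal K * diam_weight s (U i) + ennreal (1/2 * (1/2) ^ Suc i)"
    \<comment> \<open>A set of diameter 0 has weight 0, while \<open>mass\<close> asks for a
      positive length. It is put into an interval with \<open>K * r powr s = \<eta>\<close>; these
      allowances sum to 1/2.\<close>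
    proof (cases "diameter (U i) = 0")
      case True
      define \<eta> where "\<eta> = 1/2 * (1/2 :: real) ^ Suc i"
      have "0 < \<eta>" by (simp add: \<eta>_def)
      define r where "r = (\<eta> / K) powr (1 / s)"
      have "0 < r" using \<open>0 < \<eta>\<close> K(1) by (simp add: r_def)
      have "K * r powr s = \<eta>" using \<open>0 < \<eta>\<close> K(1) s(1) by (simp add: r_def powr_powr)
      obtain p where "U i \<subseteq> {p..p + diameter (U i)}" using subset_interval_diameter[OF U(2)] by blast
      then have "U i \<subseteq> {p..p + r}" using True \<open>0 < r\<close> by auto
      from mass[OF this \<open>0 < r\<close>] obtain V where "V \<in> sets P" "{a \<in> space P. code a \<in> U i} \<subseteq> V"
        "emeasure P V \<le> ennreal \<eta>" unfolding \<open>K * r powr s = \<eta>\<close> by blast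
      then show ?thesis unfolding \<eta>_def[symmetric] by (meson add_increasing order_trans zero_le order_refl)
    next
      case False
      then have pos: "0 < diameter (U i)" using diameter_ge_0[OF U(2)[of i]] by simp
      obtain p where "U i \<subseteq> {p..p + diameter (U i)}"
        using subset_interval_diameter[OF U(2)] by blast
      from mass[OF this pos] obtain V where V: "V \<in> sets P" "{a \<in> space P. code a \<in> U i} \<subseteq> V"
        "emeasure P V \<le> ennreal (K * diameter (U i) powr s)" by blast
      have "ennreal (K * diameter (U i) powr s) = ennreal K * diam_weight s (U i)"
        using False s(1) K(1) by (auto simp: diam_weight_def ennreal_mult)
      then have "emeasure P V \<le> ennreal K * diam_weight s (U i) + ennreal (1/2 * (1/2) ^ Suc i)"
        using V(3) by (simp add: add_increasing2)
      then show ?thesis using V(1,2) by blast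
    qed
  qed
  from choice[OF this] obtain V where V: "\<And>i. V i \<in> sets P" "\<And>i. {a \<in> space P. code a \<in> U i} \<subseteq> V i"
    "\<And>i. emeasure P (V i) \<le> ennreal K * diam_weight s (U i) + ennreal (1/2 * (1/2) ^ Suc i)"
    by blast
  have "space P \<subseteq> (\<Union>i. V i)" using code(1) U(1) V(2) by blast
  then have "emeasure P (space P) \<le> emeasure P (\<Union>i. V i)"
    using V(1) by (intro emeasure_mono sets.countable_UN) auto
  also have "\<dots> \<le> (\<Sum>i. emeasure P (V i))"
    using V(1) by (intro emeasure_subadditive_countably) auto
  also have "\<dots> \<le> (\<Sum>i. ennreal K * diam_weight s (U i) + ennreal (1/2 * (1/2) ^ Suc i))"
    using V(3) by (intro suminf_le) auto
  also have "\<dots> = ennreal K * (\<Sum>i. diam_weight s (U i)) + (\<Sum>i. ennreal (1/2 * (1/2) ^ Suc i))"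
    by (simp add: suminf_add[symmetric])
  also have "(\<Sum>i. ennreal (1/2 * (1/2) ^ Suc i)) = ennreal (1/2)"
    using sums_mult[OF power_half_series, of "1/2"] by (intro suminf_ennreal_eq) auto
  also have "ennreal K * (\<Sum>i. diam_weight s (U i)) + ennreal (1/2) \<le>
      ennreal K * ennreal (1 / (4 * K)) + ennreal (1/2)"
    using U(3) by (intro add_right_mono mult_left_mono) auto
  also have "\<dots> = ennreal (K * (1 / (4 * K)) + 1/2)"
    using K(1) by (subst ennreal_mult[symmetric], simp, simp, subst ennreal_plus) auto
  also have "\<dots> < 1" using K(1) by (simp add: ennreal_less_one_iff)
  finally show False using P.emeasure_space_1 by (simp add: P_def)
qed

end

section \<open>The dimension of the level set\<close>

lemma frontier_interval_subset:
  fixes S :: "real set"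
  assumes "open S" "is_interval S" "bounded S"
  shows "frontier S \<subseteq> {Inf S, Sup S}"
proof
  fix x assume "x \<in> frontier S"
  then have x: "x \<in> closure S" "x \<notin> S"
    using \<open>open S\<close> by (auto simp: frontier_def interior_open)
  then have "S \<noteq> {}" by auto
  have bdd: "bdd_below S" "bdd_above S"
    using \<open>bounded S\<close> bounded_imp_bdd_below bounded_imp_bdd_above by auto
  have "closure S \<subseteq> {Inf S..Sup S}"
    using bdd by (intro closure_minimal) (auto intro: cInf_lower cSup_upper)
  then have between: "Inf S \<le> x" "x \<le> Sup S" using x(1) by auto
  have "(\<forall>w\<in>S. x \<le> w) \<or> (\<forall>w\<in>S. w \<le> x)"
    using \<open>is_interval S\<close> x(2) unfolding is_interval_1 by (meson linear)
  then show "x \<in> {Inf S, Sup S}"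
  proof
    assume "\<forall>w\<in>S. x \<le> w"
    then have "x \<le> Inf S" using \<open>S \<noteq> {}\<close> by (intro cInf_greatest) auto
    then show ?thesis using between by simp
  next
    assume "\<forall>w\<in>S. w \<le> x"
    then have "Sup S \<le> x" using \<open>S \<noteq> {}\<close> by (intro cSup_least) auto
    then show ?thesis using between by simp
  qed
qed

context full_branches
begin

lemma countable_branch_frontiers: "countable (\<Union>b\<in>{1..}. frontier (J b))"
proof (rule countable_UN)
  fix b :: nat assume b: "b \<in> {1..}"
  have "bounded (J b)" using b bounded_subset[OF bounded_closed_interval branch_subset[of b]] by simp
  then have "frontier (J b) \<subseteq> {Inf (J b), Sup (J b)}"
    using b branch_open branch_interval by (intro frontier_interval_subset) auto
  then show "countable (frontier (J b))" by (meson countable_finite finite.intros finite_subset)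
qed simp

text \<open>\<open>T\<close> is injective on each branch, and the rest of \<open>I_star J\<close>
  consists of branch boundary points, countably many whatever \<open>T\<close> does there.\<close>

lemma countable_preimage:
  assumes "countable B" shows "countable {x \<in> I_star J. T x \<in> B}"
proof (rule countable_subset)
  show "{x \<in> I_star J. T x \<in> B} \<subseteq>
      (\<Union>b\<in>{1..}. frontier (J b)) \<union> (\<Union>b\<in>{1..}. {x \<in> J b. T x \<in> B})"
    by (auto simp: I_star_def closure_Un_frontier)
  have "countable {x \<in> J b. T x \<in> B}" if "1 \<le> b" for b
  proof (rule countable_image_inj_on)
    show "countable (T ` {x \<in> J b. T x \<in> B})"
      using assms by (rule countable_subset[rotated]) auto
    show "inj_on T {x \<in> J b. T x \<in> B}"
      using branch_inj[OF that] by (rule inj_on_subset) auto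
  qed
  then show "countable ((\<Union>b\<in>{1..}. frontier (J b)) \<union> (\<Union>b\<in>{1..}. {x \<in> J b. T x \<in> B}))"
    by (intro countable_Un countable_branch_frontiers countable_UN) auto
qed

text \<open>Induction on the order, peeling off the first application of \<open>T\<close>.
  Countability makes the set null for every positive exponent.\<close>

lemma countable_exceptional_set: "countable (exceptional_set T J)"
proof -
  define A where "A = {0, 1} \<union> (\<Union>b\<in>{1..}. frontier (J b))"
  have "countable A" unfolding A_def using countable_branch_frontiers by auto
  have "countable (iter_preimage (I_star J) T k A)" for k
  proof (induction k)
    case 0
    then show ?case using \<open>countable A\<close> by (simp add: iter_preimage_def iter_dom_def)
  next
    case (Suc k)
    have "iter_preimage (I_star J) T (Suc k) A \<subseteq>
        {x \<in> I_star J. T x \<in> iter_preimage (I_star J) T k A}"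
    proof
      fix x assume x: "x \<in> iter_preimage (I_star J) T (Suc k) A"
      then have "(T ^^ j) x \<in> I_star J" if "j < Suc k" for j
        using that by (simp add: iter_preimage_def iter_dom_def)
      from this[of 0] this[of "Suc _"] x show "x \<in> {x \<in> I_star J. T x \<in> iter_preimage (I_star J) T k A}"
        by (simp add: iter_preimage_def iter_dom_def funpow_Suc_right del: funpow.simps(2))
    qed
    then show ?case using countable_preimage[OF Suc] by (rule countable_subset)
  qed
  then show ?thesis unfolding exceptional_set_def A_def[symmetric] by (intro countable_UN) auto
qed

lemma mean_log_at_top:
  assumes "\<And>j. Suc j \<le> a j" shows "filterlim (mean_log a) at_top sequentially"
  unfolding filterlim_at_top
proof
  fix Z :: real
  \<comment> \<open>With \<open>ln R = Z + 1\<close>, the bound \<open>n * ln R - R\<close> is at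
    least \<open>n * Z\<close> as soon as \<open>n\<close> reaches \<open>R\<close>.\<close>
  define R where "R = exp (Z + 1)"
  have "Z \<le> mean_log a n" if n: "max 1 (nat \<lceil>R\<rceil>) \<le> n" for n
  proof -
    have "1 \<le> n" "R \<le> real n" using n by linarith+
    have "real n * Z \<le> real n * ln R - R"
      using \<open>R \<le> real n\<close> by (simp add: R_def algebra_simps)
    also have "\<dots> \<le> ln (fact n)" by (rule ln_fact_ge) (simp add: R_def)
    also have "\<dots> = (\<Sum>j<n. ln (real (Suc j)))"
      by (induction n) (auto simp: ln_mult_pos simp del: of_nat_Suc)
    also have "\<dots> \<le> (\<Sum>j<n. ln (real (a j)))"
    proof (rule sum_mono)
      fix j show "ln (real (Suc j)) \<le> ln (real (a j))"
        using assms[of j] by (subst ln_le_cancel_iff) auto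
    qed
    finally show ?thesis using \<open>1 \<le> n\<close> by (simp add: mean_log_def field_simps)
  qed
  then show "\<forall>\<^sub>F n in sequentially. Z \<le> mean_log a n" by (rule eventually_sequentiallyI)
qed

lemma lyapunov_spectrum_infinity:
  assumes "\<forall>x \<in> limit_set T J. \<forall>n\<ge>1. (T ^^ (n - 1)) x \<in> (\<Union>k\<in>{1..}. J k)"
  shows "lyapunov_spectrum T J \<infinity> = ereal (1 / \<gamma>)"
  unfolding lyapunov_spectrum_def
proof (rule hausdorff_dim_eqI)
  show "0 < 1 / \<gamma>" using gamma by simp
  let ?L = "lyapunov_level_set T J \<infinity>"
  let ?G = "{x. \<exists>a. coded a x \<and> filterlim (mean_log a) at_top sequentially}"
  have L_sub: "?L \<subseteq> ?G \<union> exceptional_set T J"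
  proof
    fix x assume "x \<in> ?L"
    then have lyap: "has_lyapunov_exponent T J x \<infinity>" by (simp add: lyapunov_level_set_def)
    show "x \<in> ?G \<union> exceptional_set T J"
    proof (cases "x \<in> exceptional_set T J")
      case False
      \<comment> \<open>Existence of the first derivative already places \<open>x\<close> in
        \<open>I_star J\<close>, so the standing assumption applies and provides the digits.\<close>
      from lyap obtain d where "iter_deriv (I_star J) T 1 x d"
        unfolding has_lyapunov_exponent_def by blast
      then have "x \<in> limit_set T J"
        using False by (simp add: limit_set_def iter_deriv_on_def iter_dom_def)
      then have "\<exists>b\<ge>1. (T ^^ j) x \<in> J b" for j
        using assms[rule_format, of x "Suc j"] by auto
      then obtain a where "\<And>j. 1 \<le> a j" "\<And>j. (T ^^ j) x \<in> J (a j)" by metis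
      then have "coded a x" by (simp add: coded_def digits_def)
      then show ?thesis using lyap lyapunov_infinity_iff by blast
    qed simp
  qed
  show "hausdorff_measure s ?L = 0" if "1 / \<gamma> < s" for s
  proof -
    have "0 < s" using that \<open>0 < 1 / \<gamma>\<close> by linarith
    then have "hausdorff_measure s (?G \<union> exceptional_set T J) = 0"
      using hausdorff_measure_Un_eq_0 hausdorff_measure_fast_growth[OF that]
        hausdorff_measure_countable[OF _ countable_exceptional_set] by blast
    then show ?thesis using hausdorff_measure_mono[OF L_sub, of s] by simp
  qed
  obtain M where M: "1 \<le> M" "\<And>b. M \<le> b \<Longrightarrow> closure (J b) \<subseteq> {0<..<1}"
    using branch_closure_inside by blast
  \<comment> \<open>Digits of at least \<open>M\<close> keep the branch closures inside
    \<open>{0<..<1}\<close>, so a point with this code exists; growth at least like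
    \<open>j + 1\<close> makes its exponent infinite.\<close>
  have "\<exists>x\<in>?L. coded a x" if a: "\<And>j. a j \<in> {M + j..<M + 2 * j + 1}" for a
  proof -
    have ge: "M + j \<le> a j" for j using a[of j] by simp
    have "digits a" using ge M(1) by (meson digits_def le_add1 order_trans)
    moreover have "closure (J (a j)) \<subseteq> {0<..<1}" for j
      using ge[of j] by (intro M(2)) simp
    ultimately obtain x where x: "coded a x" using coded_exists by blast
    have "Suc j \<le> a j" for j using ge[of j] M(1) by simp
    then have "has_lyapunov_exponent T J x \<infinity>"
      using mean_log_at_top lyapunov_infinity_iff[OF x] by blast
    moreover have "x \<in> {0..1}" using coded_cyl[OF x, of 0] by simp
    ultimately show ?thesis using x by (auto simp: lyapunov_level_set_def)
  qed
  then show "hausdorff_measure s ?L \<noteq> 0" if "0 < s" "s < 1 / \<gamma>" for s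
    using hausdorff_measure_coded_pos[OF that M(1)] by blast
qed

end

section \<open>From Markov--Renyi maps to full branches\<close>

text \<open>On an open branch \<open>T\<close> agrees with its extension, so differentiability,
  derivative bounds and injectivity pass to \<open>T\<close>.\<close>

lemma markov_renyi_full_branches:
  assumes "markov_renyi T J \<gamma>" shows "\<exists>C. full_branches T J \<gamma> C"
proof -
  from assms have J: "open (J b)" "is_interval (J b)" "J b \<noteq> {}" "J b \<subseteq> {0..1}"
      "closure (T ` J b) = {0..1}" if "1 \<le> b" for b
    using that unfolding markov_renyi_def by blast+
  from assms have disj: "disjoint_family_on J {1..}" and "1 < \<gamma>"
    unfolding markov_renyi_def by blast+
  from assms have "\<exists>Tn. (\<forall>b\<ge>1. (\<exists>U. closure (J b) \<subseteq> U \<and> C1_diffeo_on (Tn b) U) \<and>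
        (\<forall>x\<in>J b. Tn b x = T x)) \<and>
      (\<exists>C>1. \<forall>b\<ge>1. \<forall>x\<in>closure (J b).
        inverse C * real b powr \<gamma> \<le> \<bar>deriv (Tn b) x\<bar> \<and> \<bar>deriv (Tn b) x\<bar> \<le> C * real b powr \<gamma>)"
    unfolding markov_renyi_def by (elim conjE)
  then obtain Tn C where Tn: "\<And>b. 1 \<le> b \<Longrightarrow> \<exists>U. closure (J b) \<subseteq> U \<and> C1_diffeo_on (Tn b) U"
      "\<And>b x. 1 \<le> b \<Longrightarrow> x \<in> J b \<Longrightarrow> Tn b x = T x"
    and C: "1 < C" "\<And>b x. 1 \<le> b \<Longrightarrow> x \<in> closure (J b) \<Longrightarrow>
        inverse C * real b powr \<gamma> \<le> \<bar>deriv (Tn b) x\<bar> \<and> \<bar>deriv (Tn b) x\<bar> \<le> C * real b powr \<gamma>"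
    by metis
  have DERIV: "(T has_real_derivative deriv (Tn b) x) (at x)" if b: "1 \<le> b" "x \<in> J b" for b x
  proof -
    obtain U where U: "closure (J b) \<subseteq> U" "C1_diffeo_on (Tn b) U" using Tn(1)[OF b(1)] by blast
    then have "Tn b differentiable at x"
      using b(2) closure_subset[of "J b"] by (auto simp: C1_diffeo_on_def C1_differentiable_on_eq)
    then have "(Tn b has_real_derivative deriv (Tn b) x) (at x)"
      by (simp add: DERIV_deriv_iff_real_differentiable)
    then show ?thesis
      by (rule has_field_derivative_transform_within_open[OF _ J(1)[OF b(1)] b(2) Tn(2)[OF b(1)]])
  qed
  have inj: "inj_on T (J b)" if b: "1 \<le> b" for b
  proof -
    obtain U where U: "closure (J b) \<subseteq> U" "C1_diffeo_on (Tn b) U" using Tn(1)[OF b] by blast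
    then have "inj_on (Tn b) (J b)"
      using closure_subset unfolding C1_diffeo_on_def by (meson inj_on_subset order_trans)
    then show ?thesis using Tn(2)[OF b] by (simp add: inj_on_def)
  qed
  \<comment> \<open>Continuity and injectivity make the image an open interval, which equals the
    interior of its closure \<open>{0..1}\<close>.\<close>
  have image: "T ` J b = {0<..<1}" if b: "1 \<le> b" for b
  proof -
    have cont: "continuous_on (J b) T"
      using DERIV[OF b] by (meson DERIV_isCont continuous_at_imp_continuous_on)
    then have "open (T ` J b)"
      using injective_into_1d_imp_open_map_UNIV[OF J(1)[OF b] cont inj[OF b]] by simp
    moreover have "convex (T ` J b)"
      using connected_continuous_image[OF cont] J(2)[OF b]
      by (simp add: is_interval_connected_1 flip: is_interval_convex_1)
    ultimately show ?thesis
      using convex_interior_closure[of "T ` J b"] J(5)[OF b] by (simp add: interior_open)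
  qed
  have "full_branches T J \<gamma> C"
  proof
    fix b :: nat and x :: real assume b: "1 \<le> b" "x \<in> J b"
    show "T differentiable at x" using DERIV[OF b] real_differentiable_def by blast
    have "deriv T x = deriv (Tn b) x" using DERIV[OF b] by (rule DERIV_imp_deriv)
    then show "inverse C * real b powr \<gamma> \<le> \<bar>deriv T x\<bar>" "\<bar>deriv T x\<bar> \<le> C * real b powr \<gamma>"
      using C(2)[OF b(1)] b(2) closure_subset by (metis subsetD)+
  qed (use J image disj C(1) \<open>1 < \<gamma>\<close> in auto)
  then show ?thesis ..
qed

theorem proposition1p6:
  fixes T :: "real \<Rightarrow> real" and J :: "nat \<Rightarrow> real set" and \<gamma> :: real
  assumes "markov_renyi T J \<gamma>"
    and "\<forall>x \<in> limit_set T J. \<forall>n\<ge>1. (T ^^ (n - 1)) x \<in> (\<Union>k\<in>{1..}. J k)"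
  shows "lyapunov_spectrum T J \<infinity> = ereal (1 / \<gamma>)"
proof -
  from markov_renyi_full_branches[OF assms(1)] obtain C where "full_branches T J \<gamma> C" ..
  then show ?thesis using assms(2) by (rule full_branches.lyapunov_spectrum_infinity)
qed

end
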